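(* Let $\mu$ be a non-atomic probability measure on $\mathbb{C}$ and let $\{z_i\}_{i\ge0}$ be a $\mu$-distributed, log-Cesàro bounded sequence of complex numbers. For each $n\in\mathbb{N}$ let $$P_n(z)=\frac{(z-z_0)(z-z_1)\cdots(z-z_n)}{z-z_{s_n}},$$ where $s_n$ is a random number distributed uniformly on the set $\{0,1,\dots,n\}$. Then, as $n\to\infty$, $\mathcal{M}(P_n)\to\mu$ almost surely and $\mathcal{M}(P_n')\to\mu$ in probability.
   Context: A sequence $\{z_i\}_{i\ge0}$ of complex numbers is $\mu$-distributed if the uniform probability measures on its first $n$ terms, $\frac{1}{n}\sum_{i=0}^{n-1}\delta_{z_i}$, converge weakly to the probability measure $\mu$ as $n\to\infty$. It is log-Cesàro bounded if the averages $\frac{1}{n}\sum_{i=0}^{n-1}\log_+|z_i|$, $n\ge1$, form a bounded sequence, where $\log_+x=\max(\log x,0)$ (and $\log_+0=0$). For a non-constant polynomial $P$, $\mathcal{M}(P)$ denotes the uniform probability measure on the multiset of zeros of $P$ (zeros counted with multiplicity). Convergence of random probability measures, almost surely or in probability, is with respect to the topology of weak convergence of probability measures on $\mathbb{C}$. *)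

theory Defs
  imports
    "HOL-Probability.Probability"
    "HOL-Computational_Algebra.Computational_Algebra"
begin

section \<open>Probability measures on the complex plane and weak convergence\<close>

definition borel_probs :: "complex measure set" where
  "borel_probs = {\<nu>. prob_space \<nu> \<and> sets \<nu> = sets borel}"

text \<open>
  The coarsest topology on the set of Borel probability measures that makes
  \<open>\<nu> \<mapsto> \<integral>f d\<nu>\<close> continuous for every bounded continuous real function \<open>f\<close>.
\<close>

definition weak_topology :: "complex measure topology" where
  "weak_topology = topology_generated_by
     {{\<nu> \<in> borel_probs. integral\<^sup>L \<nu> f \<in> V} | (f :: complex \<Rightarrow> real) V.
        continuous_on UNIV f \<and> bounded (range f) \<and> open V}"

lemma topspace_weak_topology [simp]: "topspace weak_topology = borel_probs"
proof -
  have "borel_probs \<in> {{\<nu> \<in> borel_probs. integral\<^sup>L \<nu> f \<in> V} | (f :: complex \<Rightarrow> real) V.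
        continuous_on UNIV f \<and> bounded (range f) \<and> open V}"
    by (rule CollectI, rule exI[of _ "\<lambda>_. 0"], rule exI[of _ UNIV]) auto
  then show ?thesis
    unfolding weak_topology_def topology_generated_by_topspace by auto
qed

lemma limitin_weak_topology_iff:
  "limitin weak_topology \<nu> \<mu> F \<longleftrightarrow>
     \<mu> \<in> borel_probs \<and> (\<forall>\<^sub>F n in F. \<nu> n \<in> borel_probs) \<and>
     (\<forall>f :: complex \<Rightarrow> real. continuous_on UNIV f \<and> bounded (range f) \<longrightarrow>
        ((\<lambda>n. integral\<^sup>L (\<nu> n) f) \<longlongrightarrow> integral\<^sup>L \<mu> f) F)"
    (is "?L \<longleftrightarrow> ?R")
proof
  assume L: ?L
  have mu: "\<mu> \<in> borel_probs" using limitin_topspace[OF L] by simp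
  have ev: "\<forall>\<^sub>F n in F. \<nu> n \<in> borel_probs"
    using L mu openin_topspace[of weak_topology] unfolding limitin_def by auto
  have "((\<lambda>n. integral\<^sup>L (\<nu> n) f) \<longlongrightarrow> integral\<^sup>L \<mu> f) F"
    if f: "continuous_on UNIV f" "bounded (range f)" for f :: "complex \<Rightarrow> real"
  proof (rule topological_tendstoI)
    fix V :: "real set" assume V: "open V" "integral\<^sup>L \<mu> f \<in> V"
    have "openin weak_topology {\<nu> \<in> borel_probs. integral\<^sup>L \<nu> f \<in> V}"
      unfolding weak_topology_def by (rule topology_generated_by_Basis) (use f V in blast)
    then have "\<forall>\<^sub>F n in F. \<nu> n \<in> {\<nu> \<in> borel_probs. integral\<^sup>L \<nu> f \<in> V}"
      using L V mu unfolding limitin_def by blast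
    then show "\<forall>\<^sub>F n in F. integral\<^sup>L (\<nu> n) f \<in> V"
      by (rule eventually_mono) simp
  qed
  with mu ev show ?R by blast
next
  assume R: ?R
  define S where "S = {{\<nu> \<in> borel_probs. integral\<^sup>L \<nu> f \<in> V} | (f :: complex \<Rightarrow> real) V.
        continuous_on UNIV f \<and> bounded (range f) \<and> open V}"
  have "\<forall>\<^sub>F n in F. \<nu> n \<in> U" if "generate_topology_on S U" "\<mu> \<in> U" for U
    using that
  proof (induction U)
    case (Int a b)
    then show ?case by (auto intro: eventually_conj)
  next
    case (UN K)
    then obtain k where "k \<in> K" "\<mu> \<in> k" "\<forall>\<^sub>F n in F. \<nu> n \<in> k" by blast
    then show ?case by (auto elim: eventually_mono)
  next
    case (Basis s)
    then obtain f :: "complex \<Rightarrow> real" and V where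
      s: "s = {\<nu> \<in> borel_probs. integral\<^sup>L \<nu> f \<in> V}"
      and f: "continuous_on UNIV f" "bounded (range f)" and V: "open V"
      unfolding S_def by blast
    have "\<forall>\<^sub>F n in F. integral\<^sup>L (\<nu> n) f \<in> V"
      using R f V Basis(2) s by (intro topological_tendstoD[of _ "integral\<^sup>L \<mu> f"]) auto
    with R show ?case unfolding s by (auto elim: eventually_elim2)
  qed auto
  with R show ?L
    unfolding limitin_def topspace_weak_topology
    unfolding weak_topology_def openin_topology_generated_by_iff S_def by blast
qed

text \<open>
  A measure with no atoms. On the Borel sets of the plane, atoms are (up to null sets) points
  of positive mass.
\<close>

definition non_atomic :: "complex measure \<Rightarrow> bool" where
  "non_atomic \<mu> \<longleftrightarrow> (\<forall>z. emeasure \<mu> {z} = 0)"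

text \<open>
  Convergence in probability of random elements of a topological space: the random elements have
  to be measurable, and every neighbourhood of the limit is eventually hit with probability
  close to one.
\<close>

definition tendsto_in_prob ::
    "'w measure \<Rightarrow> 'b topology \<Rightarrow> (nat \<Rightarrow> 'w \<Rightarrow> 'b) \<Rightarrow> 'b \<Rightarrow> bool" where
  "tendsto_in_prob M T X x \<longleftrightarrow>
     x \<in> topspace T \<and>
     (\<forall>n U. openin T U \<longrightarrow> {\<omega> \<in> space M. X n \<omega> \<in> U} \<in> sets M) \<and>
     (\<forall>U. openin T U \<and> x \<in> U \<longrightarrow>
        (\<lambda>n. measure M {\<omega> \<in> space M. X n \<omega> \<notin> U}) \<longlonglongrightarrow> 0)"

section \<open>Empirical measures\<close>

text \<open>
  \<open>pmf_of_multiset {#}\<close> is an unspecified probability distribution; below, the multiset is empty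
  only for finitely many indices \<open>n\<close>, which do not affect the limits.
\<close>

definition uniform_on_mset :: "complex multiset \<Rightarrow> complex measure" where
  "uniform_on_mset A = distr (measure_pmf (pmf_of_multiset A)) borel (\<lambda>x. x)"

definition empirical_measure :: "(nat \<Rightarrow> complex) \<Rightarrow> nat \<Rightarrow> complex measure" where
  "empirical_measure z n = uniform_on_mset (image_mset z (mset_set {..<n}))"

definition zeros_measure :: "complex poly \<Rightarrow> complex measure" where
  "zeros_measure P = uniform_on_mset (proots P)"

definition mu_distributed :: "complex measure \<Rightarrow> (nat \<Rightarrow> complex) \<Rightarrow> bool" where
  "mu_distributed \<mu> z \<longleftrightarrow> limitin weak_topology (empirical_measure z) \<mu> sequentially"

definition log_plus :: "real \<Rightarrow> real" where
  "log_plus x = (if x = 0 then 0 else max (ln x) 0)"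

definition log_Cesaro_bounded :: "(nat \<Rightarrow> complex) \<Rightarrow> bool" where
  "log_Cesaro_bounded z \<longleftrightarrow>
     bounded ((\<lambda>n. (\<Sum>i<n. log_plus (cmod (z i))) / real n) ` {1..})"

section \<open>The polynomial with one root removed\<close>

text \<open>The polynomial division is exact for \<open>k \<le> n\<close>.\<close>

definition root_removed :: "(nat \<Rightarrow> complex) \<Rightarrow> nat \<Rightarrow> nat \<Rightarrow> complex poly" where
  "root_removed z n k = (\<Prod>i\<le>n. [:- z i, 1:]) div [:- z k, 1:]"

end

theory Submission
  imports Defs "HOL-Complex_Analysis.Complex_Analysis"
begin

text \<open>
  The first claim is immediate, since removing one root does not affect the limit of the
  empirical measures. For the second, put \<open>L = P' / P = \<Sum>\<^sub>i 1 / (x - z\<^sub>i)\<close>. A compactly supported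
  continuous test function is, up to a uniformly small error, a logarithmic potential
  \<open>w \<mapsto> \<integral> h(x) ln |x - w| dx\<close> with bounded, compactly supported \<open>h\<close> of total mass \<open>0\<close>, so that
  integrating it against the difference of the critical and the zero measures amounts to
  bounding \<open>(1/n) \<integral> |ln |L|| dx\<close> over a ball. The positive part of \<open>ln |L|\<close> is harmless because
  \<open>1 / |x|\<close> is locally integrable. The negative part is uniformly integrable by log-Cesaro
  boundedness, and for fixed \<open>x\<close> it exceeds \<open>\<delta> n\<close> only if the removed summand \<open>1 / (x - z\<^sub>k)\<close>
  nearly equals the full sum, which confines \<open>z\<^sub>k\<close> to a tiny ball or to a neighbourhood of infinity.
  As \<open>\<mu>\<close> has no atoms, this happens for a vanishing proportion of the indices \<open>k\<close>.
\<close>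

section \<open>Logarithmic potentials in the plane\<close>

text \<open>Equidistribution of the zeros alone does not control the critical points. For the
  \<open>N\<close>-th roots of unity, \<open>L\<close> is exponentially small at each point of the
  open disc and all critical points sit at 0, while the zeros spread over the circle. Removing one
  root leaves \<open>L\<close> close to \<open>- 1 / (x - z k)\<close>, which is of order one: the
  random removal is what excludes near-perfect cancellation. The cancellation estimate is pointwise,
  for one \<open>x\<close> and most \<open>k\<close>, whereas the potentials ask for one
  \<open>k\<close> and an integral over \<open>x\<close>; averaging over \<open>k\<close> links the
  two. Log-Cesaro boundedness does not make the numbers \<open>log_plus (cmod (z i))\<close>
  uniformly integrable. It suffices because the upper bound for \<open>ln |P|\<close> on a ball is
  free of \<open>x\<close>, hence merely multiplies the area where cancellation occurs. Uniform
  integrability in \<open>x\<close> is asked only of the singularities of \<open>ln |P'|\<close>,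
  wherever the critical points lie.\<close>

lemma lborel_translate:
  fixes f :: "complex \<Rightarrow> real"
  assumes [measurable]: "f \<in> borel_measurable borel"
  shows integrable_lborel_translate: "integrable lborel (\<lambda>z. f (z + w)) \<longleftrightarrow> integrable lborel f"
    and integral_lborel_translate: "(\<integral>z. f (z + w) \<partial>lborel) = (\<integral>z. f z \<partial>lborel)"
proof -
  have *: "lborel = distr lborel borel (\<lambda>z. z + w)"
    using lborel_distr_plus[of w] by (subst add.commute) (rule sym)
  show "integrable lborel (\<lambda>z. f (z + w)) \<longleftrightarrow> integrable lborel f"
    by (subst (2) *) (simp add: integrable_distr_eq)
  show "(\<integral>z. f (z + w) \<partial>lborel) = (\<integral>z. f z \<partial>lborel)"
    by (subst (2) *) (simp add: integral_distr)
qed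

section \<open>An integrable majorant for planar singularities\<close>

definition inv_bump :: "complex \<Rightarrow> real" where
  "inv_bump z = (if cmod z < 1 then 1 / cmod z else 0)"

lemma inv_bump_nonneg [simp]: "0 \<le> inv_bump z"
  by (simp add: inv_bump_def)

lemma borel_measurable_inv_bump [measurable]: "inv_bump \<in> borel_measurable borel"
  unfolding inv_bump_def by measurable

text \<open>Dyadic shells replace polar coordinates: where \<open>cmod z\<close> lies between
  \<open>(1/2) ^ Suc j\<close> and \<open>(1/2) ^ j\<close> the value is at most
  \<open>2 * 2 ^ j\<close>, and the ball of radius \<open>(1/2) ^ j\<close> has area
  \<open>pi / 4 ^ j\<close>, so the bounds sum to a geometric series. By translation invariance the
  integral does not depend on where the singularity sits, which makes later bounds uniform in the
  zeros and critical points.\<close>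

lemma integrable_inv_bump: "integrable lborel inv_bump"
proof (rule integrableI_nonneg)
  have pointwise: "ennreal (inv_bump z) \<le> (\<Sum>j. ennreal (2 * 2 ^ j) * indicator (ball 0 ((1/2) ^ j)) z)" for z
  proof (cases "z = 0 \<or> cmod z \<ge> 1")
    case False
    define j where "j = (LEAST j. (1/2) ^ Suc j \<le> cmod z)"
    have "\<exists>j. (1/2) ^ j < cmod z" using False by (intro real_arch_pow_inv) auto
    then obtain i where i: "(1/2) ^ i < cmod z" by blast
    have "(1/2) ^ Suc i \<le> (1/2::real) ^ i" by (rule power_decreasing) auto
    with i have ex: "(1/2) ^ Suc i \<le> cmod z" by linarith
    have lo: "(1/2) ^ Suc j \<le> cmod z" unfolding j_def by (rule LeastI[of _ i]) (rule ex)
    have hi: "cmod z < (1/2) ^ j"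
    proof (cases j)
      case 0 then show ?thesis using False by simp
    next
      case (Suc l)
      then have "\<not> (1/2) ^ Suc l \<le> cmod z" unfolding j_def using not_less_Least lessI by metis
      then show ?thesis using Suc by simp
    qed
    have "1 / cmod z \<le> 2 * 2 ^ j"
      using lo False by (simp add: field_simps power_divide)
    then have "ennreal (inv_bump z) \<le> ennreal (2 * 2 ^ j) * indicator (ball 0 ((1/2) ^ j)) z"
      using hi False by (simp add: inv_bump_def ennreal_leI)
    also have "\<dots> \<le> (\<Sum>j. ennreal (2 * 2 ^ j) * indicator (ball 0 ((1/2) ^ j)) z)"
    proof -
      define f where "f = (\<lambda>j. ennreal (2 * 2 ^ j) * indicator (ball 0 ((1/2) ^ j)) z)"
      have "sum f {j} \<le> suminf f" by (rule sum_le_suminf) auto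
      then have "f j \<le> suminf f" by simp
      then show ?thesis by (simp only: f_def)
    qed
    finally show ?thesis .
  next
    case True
    then have "inv_bump z = 0" by (auto simp: inv_bump_def)
    then show ?thesis by (simp only: ennreal_0 zero_le)
  qed
  have "(\<integral>\<^sup>+z. ennreal (inv_bump z) \<partial>lborel)
      \<le> (\<integral>\<^sup>+z. (\<Sum>j. ennreal (2 * 2 ^ j) * indicator (ball 0 ((1/2) ^ j)) z) \<partial>(lborel :: complex measure))"
    by (intro nn_integral_mono pointwise)
  also have "\<dots> = (\<Sum>j. ennreal (2 * 2 ^ j) * emeasure lborel (ball (0::complex) ((1/2) ^ j)))"
  proof (subst nn_integral_suminf)
    show "(\<lambda>z. ennreal (2 * 2 ^ j) * indicator (ball 0 ((1/2) ^ j)) z) \<in> borel_measurable (lborel :: complex measure)" for j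
      by (intro borel_measurable_times_ennreal borel_measurable_const borel_measurable_indicator) simp
    show "(\<Sum>j. \<integral>\<^sup>+z. ennreal (2 * 2 ^ j) * indicator (ball 0 ((1/2) ^ j)) z \<partial>(lborel :: complex measure))
        = (\<Sum>j. ennreal (2 * 2 ^ j) * emeasure lborel (ball (0::complex) ((1/2) ^ j)))"
      by (intro suminf_cong nn_integral_cmult_indicator) simp
  qed
  also have "\<dots> = (\<Sum>j. ennreal (2 * pi * (1/2) ^ j))"
  proof (rule suminf_cong)
    fix j
    have "2 * 2 ^ j * (pi * ((1/2) ^ j)^2) = 2 * pi * (1/2::real) ^ j"
      by (simp add: power2_eq_square power_divide)
    then show "ennreal (2 * 2 ^ j) * emeasure lborel (ball (0::complex) ((1/2) ^ j)) = ennreal (2 * pi * (1/2) ^ j)"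
      by (simp add: emeasure_ball unit_ball_vol_2 flip: ennreal_mult)
  qed
  also have "\<dots> = ennreal (\<Sum>j. 2 * pi * (1/2) ^ j)"
    by (intro suminf_ennreal2 summable_mult summable_geometric) auto
  finally show "(\<integral>\<^sup>+z. ennreal (inv_bump z) \<partial>lborel) < \<infinity>"
    using ennreal_less_top le_less_trans top.not_eq_extremum by (metis infinity_ennreal_def)
qed auto

lemma integrable_inv_bump_diff: "integrable lborel (\<lambda>z. inv_bump (z - w))"
  using integrable_lborel_translate[of inv_bump "- w"] integrable_inv_bump by simp

lemma integral_inv_bump_diff: "(\<integral>z. inv_bump (z - w) \<partial>lborel) = (\<integral>z. inv_bump z \<partial>lborel)"
  using integral_lborel_translate[of inv_bump "- w"] by simp

lemma abs_ln_cmod_le: "\<bar>ln (cmod z)\<bar> \<le> inv_bump z + cmod z"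
proof (cases "z = 0 \<or> cmod z \<ge> 1")
  case True
  then show ?thesis using ln_bound[of "cmod z"] by (cases "z = 0") (auto simp: inv_bump_def)
next
  case False
  then have "ln (1 / cmod z) \<le> 1 / cmod z" by (intro ln_bound) auto
  then show ?thesis using False by (auto simp: inv_bump_def ln_div abs_if intro: add_increasing2)
qed

text \<open>
  The truncation at level \<open>T\<close> replaces uniform integrability of the logarithmic
  singularity: \<open>y \<le> T + y\<^sup>2 / T\<close>, and \<open>(ln x)\<^sup>2 \<le> 4 / x\<close> for \<open>x < 1\<close>.
\<close>
lemma neg_ln_cmod_le:
  assumes "T > 0"
  shows "- ln (cmod z) \<le> T + 4 / T * inv_bump z"
proof (cases "z = 0 \<or> cmod z \<ge> 1")
  case True
  then show ?thesis using assms by (auto simp: inv_bump_def intro: order.trans[of _ 0])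
next
  case False
  define x where "x = cmod z"
  have x: "0 < x" "x < 1" using False by (auto simp: x_def)
  define y where "y = - ln x"
  \<comment> \<open>The logarithm is compared at \<open>1 / sqrt x\<close>: comparing at
    \<open>1 / x\<close> would give \<open>y\<^sup>2 \<le> 1 / x\<^sup>2\<close>, which is not
    integrable at 0 in the plane.\<close>
  have "ln (1 / sqrt x) \<le> 1 / sqrt x" using x by (intro ln_bound) auto
  then have "y \<le> 2 / sqrt x" using x by (simp add: y_def ln_div ln_sqrt field_simps)
  moreover have "0 \<le> y" using x by (simp add: y_def)
  ultimately have "y\<^sup>2 \<le> (2 / sqrt x)\<^sup>2" by (intro power_mono)
  then have y2: "y\<^sup>2 \<le> 4 / x" using x by (simp add: power_divide)
  have "y \<le> T + y\<^sup>2 / T"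
  proof (cases "y \<le> T")
    case False
    then have "y * T \<le> y * y" using \<open>0 \<le> y\<close> by (intro mult_left_mono) auto
    then have "y \<le> y\<^sup>2 / T" using assms by (simp add: field_simps power2_eq_square)
    then show ?thesis using assms by simp
  qed (use assms in \<open>simp add: add_increasing2\<close>)
  also have "\<dots> \<le> T + (4 / x) / T" using y2 assms by (intro add_left_mono divide_right_mono) auto
  finally show ?thesis using x by (simp add: y_def x_def inv_bump_def mult.commute)
qed

lemma integrable_ln_cmod_mult:
  fixes h :: "complex \<Rightarrow> real"
  assumes [measurable]: "h \<in> borel_measurable borel"
    and bd: "\<And>z. \<bar>h z\<bar> \<le> H" and supp: "\<And>z. R \<le> cmod z \<Longrightarrow> h z = 0"
  shows "integrable lborel (\<lambda>z. h z * ln (cmod (z - w)))"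
proof (rule Bochner_Integration.integrable_bound)
  show "integrable lborel (\<lambda>z. H * inv_bump (z - w) + H * (\<bar>R\<bar> + cmod w) * indicator (ball 0 R) z)"
    by (intro Bochner_Integration.integrable_add integrable_mult_right integrable_inv_bump_diff
        integrable_real_indicator) (auto intro: emeasure_lborel_ball_finite[unfolded infinity_ennreal_def])
  have H: "0 \<le> H" using bd[of 0] by (meson abs_ge_zero order.trans)
  show "AE z in lborel. norm (h z * ln (cmod (z - w)))
      \<le> norm (H * inv_bump (z - w) + H * (\<bar>R\<bar> + cmod w) * indicator (ball 0 R) z)"
  proof (rule AE_I2)
    fix z
    show "norm (h z * ln (cmod (z - w)))
      \<le> norm (H * inv_bump (z - w) + H * (\<bar>R\<bar> + cmod w) * indicator (ball 0 R) z)"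
    proof (cases "R \<le> cmod z")
      case False
      have "\<bar>h z\<bar> * \<bar>ln (cmod (z - w))\<bar> \<le> H * (inv_bump (z - w) + cmod (z - w))"
        by (intro mult_mono bd abs_ln_cmod_le H) auto
      also have "\<dots> \<le> H * (inv_bump (z - w) + (\<bar>R\<bar> + cmod w))"
        using False norm_triangle_ineq4[of z w] by (intro mult_left_mono add_left_mono H) auto
      finally show ?thesis using False H by (simp add: abs_mult distrib_left)
    qed (simp add: supp)
  qed
qed measurable

lemma integrable_bounded_support:
  fixes h :: "complex \<Rightarrow> real"
  assumes [measurable]: "h \<in> borel_measurable borel"
    and bd: "\<And>z. \<bar>h z\<bar> \<le> H" and supp: "\<And>z. R \<le> cmod z \<Longrightarrow> h z = 0"
  shows "integrable lborel h"
proof (rule Bochner_Integration.integrable_bound)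
  show "integrable lborel (\<lambda>z. H * indicator (ball (0::complex) R) z)"
    by (intro integrable_mult_right integrable_real_indicator) (auto intro: emeasure_lborel_ball_finite[unfolded infinity_ennreal_def])
  have H: "0 \<le> H" using bd[of 0] by (meson abs_ge_zero order.trans)
  show "AE z in lborel. norm (h z) \<le> norm (H * indicator (ball (0::complex) R) z)"
    using bd supp H by (auto simp: indicator_def abs_mult not_less split: if_splits)
qed measurable

section \<open>Jensen's formula for a linear factor\<close>

lemma circle_mean_ln_one:
  assumes c: "cmod c < 1"
  shows "((\<lambda>t. ln (cmod (1 - c * cis (2 * pi * t)))) has_integral 0) {0..1}"
proof -
  \<comment> \<open>The mean value property of the harmonic function
    \<open>ln (cmod (1 - c * u))\<close>: the argument stays in the right half plane, where the
    principal branch is holomorphic, and its value at the centre is \<open>Ln 1 = 0\<close>.\<close>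
  have holo: "(\<lambda>u. Ln (1 - c * u)) holomorphic_on cball 0 1"
  proof (intro holomorphic_intros)
    fix u :: complex assume u: "u \<in> cball 0 1"
    have "cmod (c * u) < 1" using u c
      by (auto simp: norm_mult intro: le_less_trans[OF mult_left_le])
    then have "Re (1 - c * u) > 0" using complex_Re_le_cmod[of "c * u"] by simp
    then show "1 - c * u \<notin> \<real>\<^sub>\<le>\<^sub>0" by (metis complex_nonpos_Reals_iff not_less)
  qed
  have "((\<lambda>u. Ln (1 - c * u) / (u - 0)) has_contour_integral (2 * of_real pi * \<i> * Ln (1 - c * 0))) (circlepath 0 1)"
    by (rule Cauchy_integral_circlepath_simple[OF holo]) auto
  then have "((\<lambda>t. Ln (1 - c * cis (2 * pi * t)) * (2 * pi * \<i>)) has_integral 0) {0..1}"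
    unfolding has_contour_integral vector_derivative_circlepath
    by (simp add: circlepath cis_conv_exp mult_ac)
  then have "((\<lambda>t. (Ln (1 - c * cis (2 * pi * t)) * (2 * pi * \<i>)) / (2 * pi * \<i>)) has_integral 0 / (2 * pi * \<i>)) {0..1}"
    by (rule has_integral_divide)
  then have "((\<lambda>t. Ln (1 - c * cis (2 * pi * t))) has_integral 0) {0..1}" by simp
  from has_integral_linear[OF this bounded_linear_Re]
  have "((\<lambda>t. Re (Ln (1 - c * cis (2 * pi * t)))) has_integral 0) {0..1}" by (simp add: o_def)
  moreover have "1 - c * cis (2 * pi * t) \<noteq> 0" for t
    using c by (metis eq_iff_diff_eq_0 less_irrefl mult.right_neutral norm_cis norm_mult norm_one)
  ultimately show ?thesis by (simp add: Re_Ln)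
qed

text \<open>The larger of \<open>r\<close> and \<open>cmod w\<close> is factored out, leaving a mean
  of \<open>ln (cmod (1 - c * u))\<close> with \<open>cmod c < 1\<close>. The case
  \<open>cmod w = r\<close> is left out, being met only on a null set.\<close>

lemma circle_mean_ln:
  assumes r: "r > 0" and w: "cmod w \<noteq> r"
  shows "((\<lambda>t. ln (cmod (w - r * cis (2 * pi * t)))) has_integral ln (max r (cmod w))) {0..1}"
proof -
  define m where "m = max r (cmod w)"
  define c where "c = (if cmod w < r then cnj w / r else r / w)"
  have m: "m > 0" using r by (auto simp: m_def)
  have c: "cmod c < 1" using r w by (auto simp: c_def norm_divide divide_less_eq_1)
  have eq: "cmod (w - r * cis (2 * pi * t)) = m * cmod (1 - c * cis (2 * pi * t))" for t
  proof (cases "cmod w < r")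
    case True
    \<comment> \<open>Taking out \<open>r * cis (2 * pi * t)\<close> directly would leave the
      inverse of \<open>cis (2 * pi * t)\<close>; conjugating and multiplying by the unimodular
      factor leaves its first power.\<close>
    have "cmod (w - r * cis (2 * pi * t)) = cmod (cnj (w - r * cis (2 * pi * t)) * cis (2 * pi * t))"
      by (simp add: norm_mult del: complex_cnj_diff)
    also have "cnj (w - r * cis (2 * pi * t)) * cis (2 * pi * t) = cnj w * cis (2 * pi * t) - r"
      by (simp add: algebra_simps cis_cnj cis_mult)
    also have "\<dots> = - (r * (1 - c * cis (2 * pi * t)))"
      using True r by (simp add: c_def field_simps)
    finally show ?thesis using True r by (simp add: m_def norm_mult)
  next
    case False
    then have "w - r * cis (2 * pi * t) = w * (1 - c * cis (2 * pi * t))"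
      using r by (auto simp: c_def field_simps)
    then show ?thesis using False w by (simp add: m_def norm_mult)
  qed
  have nz: "1 - c * cis (2 * pi * t) \<noteq> 0" for t
    using c by (metis eq_iff_diff_eq_0 less_irrefl mult.right_neutral norm_cis norm_mult norm_one)
  have "((\<lambda>t. ln m + ln (cmod (1 - c * cis (2 * pi * t)))) has_integral ln m + 0) {0..1}"
    using has_integral_const_real[of "ln m" 0 1] by (intro has_integral_add circle_mean_ln_one c) simp
  then show ?thesis using m nz by (simp add: eq ln_mult flip: m_def)
qed

lemma integral_circle_mean_ln:
  assumes "r > 0" "cmod w \<noteq> r"
  shows "(\<integral>t. indicator {0..1} t * ln (cmod (w - r * cis (2 * pi * t))) \<partial>lborel) = ln (max r (cmod w))"
proof -
  have nz: "w - r * cis (2 * pi * t) \<noteq> 0" for t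
    using assms by (auto simp: norm_mult dest: arg_cong[of _ _ cmod])
  have "continuous_on {0..1} (\<lambda>t. ln (cmod (w - r * cis (2 * pi * t))))"
    using nz by (intro continuous_intros) auto
  then have "set_integrable lborel {0..1} (\<lambda>t. ln (cmod (w - r * cis (2 * pi * t))))"
    by (rule borel_integrable_atLeastAtMost')
  from set_borel_integral_eq_integral(2)[OF this] integral_unique[OF circle_mean_ln[OF assms]]
  show ?thesis by (simp add: set_lebesgue_integral_def)
qed

lemma AE_lborel_cmod_neq: "AE a in lborel. cmod (a - w) \<noteq> r"
proof -
  have "sphere w r \<in> null_sets lborel"
    using negligible_sphere[of w r]
    by (subst null_sets_completion_iff[symmetric]) (auto simp: negligible_iff_null_sets)
  then show ?thesis
    by (rule AE_not_in[THEN eventually_mono]) (auto simp: dist_norm norm_minus_commute)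
qed

text \<open>Written as an integral over the whole line with an indicator, so that Fubini for two
  Lebesgue measures applies directly.\<close>

definition circle_mean :: "real \<Rightarrow> (complex \<Rightarrow> real) \<Rightarrow> complex \<Rightarrow> real" where
  "circle_mean r F z = (\<integral>t. indicator {0..1} t * F (z + r * cis (2 * pi * t)) \<partial>lborel)"

lemma borel_measurable_cis_2pi [measurable]: "(\<lambda>t. cis (2 * pi * t)) \<in> borel_measurable borel"
  by (intro borel_measurable_continuous_onI continuous_intros)

lemma borel_measurable_circle_mean [measurable]:
  assumes [measurable]: "F \<in> borel_measurable borel"
  shows "circle_mean r F \<in> borel_measurable borel"
  unfolding circle_mean_def by measurable

lemma integrable_indicator_01 [simp]: "integrable lborel (indicator {0..1::real} :: real \<Rightarrow> real)"
  by (rule integrable_real_indicator) auto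

lemma circle_mean_le:
  fixes F :: "complex \<Rightarrow> real"
  assumes [measurable]: "F \<in> borel_measurable borel" and C: "\<And>z. \<bar>F z\<bar> \<le> C"
  shows "\<bar>circle_mean r F z\<bar> \<le> C"
proof -
  have "norm (circle_mean r F z) \<le> (\<integral>t. indicator {0..1} t * C \<partial>(lborel :: real measure))"
    unfolding circle_mean_def
  proof (rule Bochner_Integration.integral_norm_bound_integral)
    show "integrable lborel (\<lambda>t. indicator {0..1} t * F (z + r * cis (2 * pi * t)))"
      by (rule Bochner_Integration.integrable_bound[OF integrable_mult_right[OF integrable_indicator_01, of C]])
         (use C in \<open>auto simp: indicator_def intro: order.trans[OF C abs_ge_self]\<close>)
    show "integrable lborel (\<lambda>t. indicator {0..1::real} t * C)"
      by (intro integrable_mult_left) simp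
  qed (use C in \<open>auto simp: indicator_def\<close>)
  then show ?thesis by simp
qed

text \<open>Circle averaging can be moved from \<open>F\<close> to \<open>g\<close>: exchange the
  integrals, translate by \<open>e t\<close>, exchange back. The support of \<open>F\<close>
  confines everything to the ball of radius \<open>R + r\<close>, so \<open>g\<close> is only asked
  to be integrable there, which admits logarithmic poles.\<close>

lemma integral_circle_mean_mult:
  fixes F g :: "complex \<Rightarrow> real"
  assumes [measurable]: "F \<in> borel_measurable borel" "g \<in> borel_measurable borel"
    and C: "\<And>z. \<bar>F z\<bar> \<le> C" and supp: "\<And>z. R \<le> cmod z \<Longrightarrow> F z = 0" and r: "r > 0"
    and g: "integrable lborel (\<lambda>z. indicator (ball 0 (R + r)) z * g z)"
  shows "(\<integral>z. circle_mean r F z * g z \<partial>lborel)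
       = (\<integral>a. F a * (\<integral>t. indicator {0..1} t * g (a - r * cis (2 * pi * t)) \<partial>lborel) \<partial>lborel)"
proof -
  define e where "e t = r * cis (2 * pi * t)" for t
  have [measurable]: "e \<in> borel_measurable borel" unfolding e_def by measurable
  have e: "cmod (e t) = r" for t using r by (simp add: e_def norm_mult)
  define f1 where "f1 = (\<lambda>t z. indicator {0..1} t * F (z + e t) * g z)"
  define f2 where "f2 = (\<lambda>t a. indicator {0..1} t * F a * g (a - e t))"
  have C0: "0 \<le> C" using C[of 0] by linarith
  have G: "integrable lborel (\<lambda>z. C * \<bar>indicator (ball 0 (R + r)) z * g z\<bar>)"
    by (intro integrable_mult_right integrable_abs g)
  have f1_le: "\<bar>f1 t z\<bar> \<le> indicator {0..1} t * (C * \<bar>indicator (ball 0 (R + r)) z * g z\<bar>)" for t z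
  proof (cases "cmod z < R + r")
    case False
    then have "R \<le> cmod (z + e t)" using norm_diff_ineq[of z "e t"] e[of t] by simp
    then show ?thesis using supp C0 by (simp add: f1_def)
  next
    case True
    then show ?thesis using C[of "z + e t"]
      by (auto simp: f1_def indicator_def abs_mult intro: mult_right_mono)
  qed
  have [measurable]: "case_prod f1 \<in> borel_measurable (lborel \<Otimes>\<^sub>M lborel)"
      "case_prod f2 \<in> borel_measurable (lborel \<Otimes>\<^sub>M lborel)"
    unfolding f1_def f2_def by measurable
  have [measurable]: "f1 t \<in> borel_measurable borel" "f2 t \<in> borel_measurable borel" for t
    unfolding f1_def f2_def by measurable
  have f2_f1: "f2 t (z + e t) = f1 t z" for t z by (simp add: f1_def f2_def)
  have i1: "integrable lborel (f1 t)" for t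
    by (rule Bochner_Integration.integrable_bound[OF integrable_mult_right[OF G, of "indicator {0..1} t"]])
       (use f1_le C0 in \<open>auto simp: abs_mult\<close>)
  have i2: "integrable lborel (f2 t)" for t
    using integrable_lborel_translate[of "f2 t" "e t"] i1[of t] by (simp add: f2_f1)
  have eq: "(\<integral>a. f2 t a \<partial>lborel) = (\<integral>z. f1 t z \<partial>lborel)" for t
    using integral_lborel_translate[of "f2 t" "e t"] by (simp add: f2_f1)
  have eqn: "(\<integral>a. norm (f2 t a) \<partial>lborel) = (\<integral>z. norm (f1 t z) \<partial>lborel)" for t
    using integral_lborel_translate[of "\<lambda>a. norm (f2 t a)" "e t"] by (simp add: f2_f1)
  define B where "B = (\<integral>z. C * \<bar>indicator (ball 0 (R + r)) z * g z\<bar> \<partial>lborel)"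
  have n1: "integrable lborel (\<lambda>t. \<integral>z. norm (f1 t z) \<partial>lborel)"
  proof (rule Bochner_Integration.integrable_bound)
    show "integrable lborel (\<lambda>t. B * indicator {0..1::real} t)" by simp
    have "(\<integral>z. norm (f1 t z) \<partial>lborel) \<le> (\<integral>z. indicator {0..1} t * (C * \<bar>indicator (ball 0 (R + r)) z * g z\<bar>) \<partial>lborel)" for t
      by (intro integral_mono integrable_norm i1 integrable_mult_right G) (use f1_le in auto)
    then have "\<bar>\<integral>z. norm (f1 t z) \<partial>lborel\<bar> \<le> B * indicator {0..1} t" for t
      by (simp add: B_def mult.commute)
    moreover have "0 \<le> B" unfolding B_def using C0 by (intro integral_nonneg_AE) auto
    ultimately show "AE t in lborel. norm (\<integral>z. norm (f1 t z) \<partial>lborel) \<le> norm (B * indicator {0..1} t)"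
      by (auto simp: abs_mult)
  qed measurable
  have I1: "integrable (lborel \<Otimes>\<^sub>M lborel) (case_prod f1)"
    by (rule lborel_pair.Fubini_integrable) (use i1 n1 in auto)
  have I2: "integrable (lborel \<Otimes>\<^sub>M lborel) (case_prod f2)"
    by (rule lborel_pair.Fubini_integrable) (use i2 n1 eqn in auto)
  have "(\<integral>z. circle_mean r F z * g z \<partial>lborel) = (\<integral>z. (\<integral>t. f1 t z \<partial>lborel) \<partial>lborel)"
    by (simp add: circle_mean_def f1_def e_def)
  also have "\<dots> = (\<integral>t. (\<integral>z. f1 t z \<partial>lborel) \<partial>lborel)" by (rule lborel_pair.Fubini_integral[OF I1])
  also have "\<dots> = (\<integral>t. (\<integral>a. f2 t a \<partial>lborel) \<partial>lborel)" by (simp add: eq)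
  also have "\<dots> = (\<integral>a. (\<integral>t. f2 t a \<partial>lborel) \<partial>lborel)" by (rule lborel_pair.Fubini_integral[OF I2, symmetric])
  also have "\<dots> = (\<integral>a. F a * (\<integral>t. indicator {0..1} t * g (a - e t) \<partial>lborel) \<partial>lborel)"
    by (simp add: f2_def mult.assoc mult.left_commute[of _ "F _"])
  finally show ?thesis by (simp add: e_def)
qed

section \<open>Uniform approximation by logarithmic potentials\<close>

lemma compact_support_bounded_uniformly_continuous:
  fixes F :: "complex \<Rightarrow> real"
  assumes cont: "continuous_on UNIV F" and supp: "\<And>z. R \<le> cmod z \<Longrightarrow> F z = 0"
  shows "\<exists>C. \<forall>z. \<bar>F z\<bar> \<le> C"
    and "e > 0 \<Longrightarrow> \<exists>d>0. \<forall>x y. dist x y < d \<longrightarrow> \<bar>F x - F y\<bar> \<le> e"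
proof -
  have "bounded (F ` cball 0 R)"
    by (intro compact_imp_bounded compact_continuous_image continuous_on_subset[OF cont]) auto
  then obtain C where C: "\<forall>z\<in>cball 0 R. \<bar>F z\<bar> \<le> C" by (auto simp: bounded_iff)
  have "\<bar>F z\<bar> \<le> max 0 C" for z using bspec[OF C, of z] supp[of z] by (cases "cmod z \<le> R") auto
  then show "\<exists>C. \<forall>z. \<bar>F z\<bar> \<le> C" by blast
  assume e: "e > 0"
  have "uniformly_continuous_on (cball 0 (R + 1)) F"
    by (intro compact_uniformly_continuous continuous_on_subset[OF cont]) auto
  then obtain d where d: "d > 0"
    "\<And>x y. cmod x \<le> R + 1 \<Longrightarrow> cmod y \<le> R + 1 \<Longrightarrow> dist x y < d \<Longrightarrow> dist (F x) (F y) < e"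
    unfolding uniformly_continuous_on_def using e by (fastforce simp: dist_commute)
  have "\<bar>F x - F y\<bar> \<le> e" if "dist x y < min d 1" for x y
  proof (cases "cmod x \<le> R + 1 \<and> cmod y \<le> R + 1")
    case True
    then show ?thesis using d(2)[of x y] that by (auto simp: dist_real_def)
  next
    case False
    have "\<bar>cmod x - cmod y\<bar> < 1" using that norm_triangle_ineq3[of x y] by (auto simp: dist_norm)
    with False have "R \<le> cmod x" "R \<le> cmod y" by auto
    then show ?thesis using supp e by simp
  qed
  then show "\<exists>d>0. \<forall>x y. dist x y < d \<longrightarrow> \<bar>F x - F y\<bar> \<le> e"
    using d(1) by (intro exI[of _ "min d 1"]) auto
qed

text \<open>
  The density \<open>h\<close> is a discrete Laplacian of \<open>F\<close> (a circle mean minus the value at the centre).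
  By Jensen's formula the potential of \<open>h\<close> is the convolution of \<open>F\<close> with the nonnegative
  kernel \<open>\<zeta> \<mapsto> ln\<^sub>+ (r / |\<zeta>|)\<close>, up to normalisation.
\<close>
lemma log_potential_dense:
  fixes F :: "complex \<Rightarrow> real"
  assumes cont: "continuous_on UNIV F" and supp: "\<And>z. R \<le> cmod z \<Longrightarrow> F z = 0" and e: "e > 0"
  obtains h H R' where "h \<in> borel_measurable borel" "\<And>z. \<bar>h z\<bar> \<le> H"
    "\<And>z. R' \<le> cmod z \<Longrightarrow> h z = 0" "(\<integral>z. h z \<partial>lborel) = 0"
    "\<And>w. \<bar>F w - (\<integral>z. h z * ln (cmod (z - w)) \<partial>lborel)\<bar> \<le> e"
proof -
  have [measurable]: "F \<in> borel_measurable borel" using cont by (rule borel_measurable_continuous_onI)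
  obtain C where C: "\<And>z. \<bar>F z\<bar> \<le> C"
    using compact_support_bounded_uniformly_continuous(1)[OF cont supp] by blast
  obtain d where d: "d > 0" "\<And>x y. dist x y < d \<Longrightarrow> \<bar>F x - F y\<bar> \<le> e"
    using compact_support_bounded_uniformly_continuous(2)[OF cont supp e] by blast
  \<comment> \<open>Within distance \<open>d\<close> the modulus of continuity of \<open>F\<close>
    applies; \<open>r \<le> 1\<close> keeps the kernel \<open>b\<close> below
    \<open>inv_bump\<close>.\<close>
  define r where "r = min d 1"
  have r: "0 < r" "r \<le> 1" "r \<le> d" using d by (auto simp: r_def)
  define b where "b z = (if 0 < cmod z \<and> cmod z < r then ln (r / cmod z) else 0)" for z
  have [measurable]: "b \<in> borel_measurable borel" unfolding b_def by measurable
  have b0: "0 \<le> b z" for z by (auto simp: b_def)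
  have b_le: "b z \<le> inv_bump z" for z
  proof (cases "0 < cmod z \<and> cmod z < r")
    case True
    then have "ln (r / cmod z) \<le> r / cmod z" by (intro ln_bound) (use r in auto)
    also have "\<dots> \<le> 1 / cmod z" using r by (simp add: divide_right_mono)
    finally show ?thesis using True r by (simp add: b_def inv_bump_def)
  qed (auto simp: b_def)
  have ib: "integrable lborel b"
    by (rule Bochner_Integration.integrable_bound[OF integrable_inv_bump]) (use b0 b_le in auto)
  then have ibw: "integrable lborel (\<lambda>a. b (a - w))" for w
    using integrable_lborel_translate[of b "- w"] by simp
  define c where "c = (\<integral>z. b z \<partial>lborel)"
  have cw: "(\<integral>a. b (a - w) \<partial>lborel) = c" for w
    using integral_lborel_translate[of b "- w"] by (simp add: c_def)
  \<comment> \<open>Normalisation divides by the mass of the kernel, which is at least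
    \<open>ln 2\<close> on the ball of half the radius, except at the centre.\<close>
  have c: "c > 0"
  proof -
    have "0 < (\<integral>z. ln 2 * indicat_real (ball (0::complex) (r / 2)) z \<partial>lborel)"
      using r by (simp add: content_ball_pos)
    also have "\<dots> \<le> c" unfolding c_def
    proof (rule integral_mono_AE)
      show "AE z in lborel. ln 2 * indicat_real (ball (0::complex) (r / 2)) z \<le> b z"
        using AE_lborel_singleton[of "0::complex"]
      proof eventually_elim
        case (elim z)
        then have "ln 2 \<le> b z" if "cmod z < r / 2"
          using that r by (auto simp: b_def field_simps)
        then show ?case using b0[of z] by (auto simp: indicator_def)
      qed
    qed (use ib in \<open>auto intro!: integrable_mult_right integrable_real_indicator
          emeasure_lborel_ball_finite[unfolded infinity_ennreal_def]\<close>)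
    finally show ?thesis .
  qed
  define h where "h z = (circle_mean r F z - F z) / c" for z
  have [measurable]: "h \<in> borel_measurable borel" unfolding h_def by measurable
  have cm_supp: "circle_mean r F z = 0" if "R + r \<le> cmod z" for z
  proof -
    have "R \<le> cmod (z + r * cis (2 * pi * t))" for t
      using that norm_diff_ineq[of z "r * cis (2 * pi * t)"] r by (simp add: norm_mult)
    then show ?thesis unfolding circle_mean_def using supp by simp
  qed
  have iF: "integrable lborel F" "integrable lborel (circle_mean r F)"
    using C supp cm_supp circle_mean_le[of F C] by (auto intro!: integrable_bounded_support)
  have iFl: "integrable lborel (\<lambda>z. F z * ln (cmod (z - w)))"
    "integrable lborel (\<lambda>z. circle_mean r F z * ln (cmod (z - w)))" for w
    using C supp cm_supp circle_mean_le[of F C] by (auto intro!: integrable_ln_cmod_mult)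
  show ?thesis
  proof (rule that)
    show "h \<in> borel_measurable borel" by fact
    show "\<bar>h z\<bar> \<le> (C + C) / c" for z
    proof -
      have "\<bar>circle_mean r F z\<bar> \<le> C" by (rule circle_mean_le) (use C in auto)
      then have "\<bar>circle_mean r F z - F z\<bar> \<le> C + C" using C[of z] by linarith
      then show ?thesis using c by (simp add: h_def divide_right_mono del: mult_2)
    qed
    show "h z = 0" if "R + r \<le> cmod z" for z
      using cm_supp[OF that] supp[of z] that r by (simp add: h_def)
    \<comment> \<open>The choice \<open>g = 1\<close> shows that a circle mean has the same integral
      as \<open>F\<close>.\<close>
    have "(\<integral>z. circle_mean r F z * 1 \<partial>lborel) = (\<integral>a. F a * (\<integral>t. indicator {0..1} t * 1 \<partial>(lborel :: real measure)) \<partial>lborel)"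
      by (rule integral_circle_mean_mult[OF _ _ C supp r(1)])
         (auto intro!: integrable_real_indicator emeasure_lborel_ball_finite[unfolded infinity_ennreal_def])
    then show "(\<integral>z. h z \<partial>lborel) = 0"
      unfolding h_def using iF by simp
    fix w
    have iFb: "integrable lborel (\<lambda>a. F a * b (a - w))"
      by (rule Bochner_Integration.integrable_bound[OF integrable_mult_right[OF ibw[of w], of C]])
         (use C b0 in \<open>auto simp: abs_mult intro!: mult_mono order.trans[OF C abs_ge_self]\<close>)
    have "(\<integral>z. circle_mean r F z * ln (cmod (z - w)) \<partial>lborel)
        = (\<integral>a. F a * (\<integral>t. indicator {0..1} t * ln (cmod (a - r * cis (2 * pi * t) - w)) \<partial>lborel) \<partial>lborel)"
      by (rule integral_circle_mean_mult[OF _ _ C supp r(1)])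
         (auto intro!: integrable_ln_cmod_mult[where H = 1 and R = "R + r"] borel_measurable_indicator)
    also have "\<dots> = (\<integral>a. F a * ln (cmod (a - w)) + F a * b (a - w) \<partial>lborel)"
    proof (rule integral_cong_AE)
      show "AE a in lborel. F a * (\<integral>t. indicator {0..1} t * ln (cmod (a - r * cis (2 * pi * t) - w)) \<partial>lborel)
          = F a * ln (cmod (a - w)) + F a * b (a - w)"
        using AE_lborel_cmod_neq[of w r] AE_lborel_cmod_neq[of w 0]
      proof eventually_elim
        case (elim a)
        have "(\<integral>t. indicator {0..1} t * ln (cmod (a - r * cis (2 * pi * t) - w)) \<partial>lborel)
            = ln (max r (cmod (a - w)))"
          using integral_circle_mean_ln[OF r(1) elim(1)] by (simp add: algebra_simps)
        also have "\<dots> = ln (cmod (a - w)) + b (a - w)"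
          using elim r by (auto simp: b_def max_def ln_div)
        finally show ?case by (simp add: distrib_left)
      qed
    qed measurable
    also have "\<dots> = (\<integral>a. F a * ln (cmod (a - w)) \<partial>lborel) + (\<integral>a. F a * b (a - w) \<partial>lborel)"
      by (intro Bochner_Integration.integral_add iFl iFb)
    finally have "(\<integral>z. h z * ln (cmod (z - w)) \<partial>lborel) = (\<integral>a. F a * b (a - w) \<partial>lborel) / c"
      unfolding h_def using iFl[of w] by (simp add: diff_divide_distrib left_diff_distrib add_divide_distrib)
    \<comment> \<open>As \<open>c\<close> is also the mass of the translated kernel,
      \<open>F w\<close> is the average of a constant against the same kernel.\<close>
    also have "F w - \<dots> = ((\<integral>a. F w * b (a - w) \<partial>lborel) - (\<integral>a. F a * b (a - w) \<partial>lborel)) / c"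
      using c by (simp add: cw diff_divide_distrib)
    also have "\<dots> = (\<integral>a. (F w - F a) * b (a - w) \<partial>lborel) / c"
      using iFb ibw[of w] by (simp add: left_diff_distrib)
    also have "\<bar>\<dots>\<bar> \<le> (\<integral>a. e * b (a - w) \<partial>lborel) / c"
    proof -
      have "norm (\<integral>a. (F w - F a) * b (a - w) \<partial>lborel) \<le> (\<integral>a. e * b (a - w) \<partial>lborel)"
      proof (rule Bochner_Integration.integral_norm_bound_integral)
        show "integrable lborel (\<lambda>a. (F w - F a) * b (a - w))"
          using iFb ibw[of w] by (simp add: left_diff_distrib)
        show "norm ((F w - F a) * b (a - w)) \<le> e * b (a - w)" for a
        proof (cases "b (a - w) = 0")
          case False
          then have "dist w a < d" using r by (auto simp: b_def dist_norm norm_minus_commute split: if_splits)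
          then show ?thesis using d(2)[of w a] b0[of "a - w"] by (simp add: abs_mult mult_right_mono)
        qed simp
      qed (simp add: ibw)
      then show ?thesis using c by (simp add: divide_right_mono)
    qed
    also have "\<dots> = e" using c by (simp add: cw)
    finally show "\<bar>F w - (\<integral>z. h z * ln (cmod (z - w)) \<partial>lborel)\<bar> \<le> e" .
  qed
qed

section \<open>The logarithmic derivative of a polynomial\<close>

lemma ln_cmod_prod_mset:
  assumes "z \<notin># A"
  shows "ln (cmod (\<Prod>x\<in>#A. (z - x))) = (\<Sum>x\<in>#A. ln (cmod (z - x)))"
  using assms
proof (induction A)
  case (add x A)
  have "(\<Prod>x\<in>#A. (z - x)) \<noteq> 0" using add.prems by (auto simp: prod_mset_zero_iff)
  then show ?case using add by (simp add: norm_mult ln_mult)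
qed simp

lemma ln_cmod_poly:
  fixes p :: "complex poly"
  assumes "poly p z \<noteq> 0"
  shows "ln (cmod (poly p z)) = ln (cmod (lead_coeff p)) + (\<Sum>x\<in>#proots p. ln (cmod (z - x)))"
proof -
  have p: "p \<noteq> 0" using assms by auto
  have "poly p z = poly (smult (lead_coeff p) (\<Prod>x\<in>#proots p. [:-x, 1:])) z"
    by (simp only: complex_poly_decompose_multiset)
  also have "\<dots> = lead_coeff p * (\<Prod>x\<in>#proots p. (z - x))"
    by (simp add: poly_prod_mset image_mset.compositionality o_def)
  finally have eq: "poly p z = lead_coeff p * (\<Prod>x\<in>#proots p. (z - x))" .
  with assms have "(\<Prod>x\<in>#proots p. (z - x)) \<noteq> 0" by auto
  moreover have "z \<notin># proots p" using assms p by simp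
  ultimately show ?thesis using p by (simp add: eq norm_mult ln_mult ln_cmod_prod_mset)
qed

lemma integral_sum_mset:
  fixes f :: "'i \<Rightarrow> 'a \<Rightarrow> real"
  assumes "\<And>i. i \<in># A \<Longrightarrow> integrable M (f i)"
  shows "integrable M (\<lambda>z. \<Sum>i\<in>#A. f i z)"
    and "(\<integral>z. (\<Sum>i\<in>#A. f i z) \<partial>M) = (\<Sum>i\<in>#A. \<integral>z. f i z \<partial>M)"
  using assms by (induction A) simp_all

lemma AE_poly_neq_0:
  fixes p :: "complex poly"
  assumes "p \<noteq> 0"
  shows "AE z in lborel. poly p z \<noteq> 0"
proof -
  have "{z. poly p z = 0} \<in> null_sets lborel"
    using poly_roots_finite[OF assms] by (intro finite_imp_null_set_lborel)
  then show ?thesis by (rule AE_not_in[THEN eventually_mono]) auto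
qed

lemma borel_measurable_poly [measurable]: "(\<lambda>z. poly (p :: complex poly) z) \<in> borel_measurable borel"
  by (intro borel_measurable_continuous_onI continuous_intros)

lemma integral_ln_cmod_poly:
  fixes h :: "complex \<Rightarrow> real" and p :: "complex poly"
  assumes [measurable]: "h \<in> borel_measurable borel"
    and h: "\<And>z. \<bar>h z\<bar> \<le> H" "\<And>z. R \<le> cmod z \<Longrightarrow> h z = 0" and p: "p \<noteq> 0"
  shows "integrable lborel (\<lambda>z. h z * ln (cmod (poly p z)))"
    and "(\<integral>z. h z * ln (cmod (poly p z)) \<partial>lborel)
       = (\<integral>z. h z \<partial>lborel) * ln (cmod (lead_coeff p)) + (\<Sum>x\<in>#proots p. \<integral>z. h z * ln (cmod (z - x)) \<partial>lborel)"
proof -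
  have AE: "AE z in lborel. h z * ln (cmod (poly p z))
      = h z * ln (cmod (lead_coeff p)) + (\<Sum>x\<in>#proots p. h z * ln (cmod (z - x)))"
    using AE_poly_neq_0[OF p]
    by eventually_elim (simp add: ln_cmod_poly distrib_left sum_mset_distrib_left)
  have ih: "integrable lborel h" by (rule integrable_bounded_support) (use h in auto)
  have il: "integrable lborel (\<lambda>z. h z * ln (cmod (z - x)))" for x
    by (rule integrable_ln_cmod_mult) (use h in auto)
  have i: "integrable lborel (\<lambda>z. h z * ln (cmod (lead_coeff p)) + (\<Sum>x\<in>#proots p. h z * ln (cmod (z - x))))"
    by (intro Bochner_Integration.integrable_add integrable_mult_left ih integral_sum_mset il)
  have [measurable]: "(\<lambda>z. \<Sum>x\<in>#proots p. h z * ln (cmod (z - x))) \<in> borel_measurable borel"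
    using integral_sum_mset(1)[OF il, where A = "proots p"] by (simp add: borel_measurable_integrable)
  show "integrable lborel (\<lambda>z. h z * ln (cmod (poly p z)))"
    by (subst integrable_cong_AE[OF _ _ AE]) (use i in auto)
  have "(\<integral>z. h z * ln (cmod (poly p z)) \<partial>lborel)
      = (\<integral>z. h z * ln (cmod (lead_coeff p)) + (\<Sum>x\<in>#proots p. h z * ln (cmod (z - x))) \<partial>lborel)"
    by (rule integral_cong_AE[OF _ _ AE]) auto
  also have "\<dots> = (\<integral>z. h z * ln (cmod (lead_coeff p)) \<partial>lborel)
      + (\<integral>z. (\<Sum>x\<in>#proots p. h z * ln (cmod (z - x))) \<partial>lborel)"
    by (intro Bochner_Integration.integral_add integrable_mult_left ih integral_sum_mset il)
  finally show "(\<integral>z. h z * ln (cmod (poly p z)) \<partial>lborel)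
       = (\<integral>z. h z \<partial>lborel) * ln (cmod (lead_coeff p)) + (\<Sum>x\<in>#proots p. \<integral>z. h z * ln (cmod (z - x)) \<partial>lborel)"
    using ih by (simp add: integral_sum_mset[OF il])
qed

lemma integrable_ball_abs_ln_diff:
  fixes p q :: "complex poly"
  assumes "p \<noteq> 0" "q \<noteq> 0"
  shows "integrable lborel (\<lambda>z. indicator (ball 0 R) z * \<bar>ln (cmod (poly p z)) - ln (cmod (poly q z))\<bar>)"
proof -
  have "integrable lborel (\<lambda>z. indicator (ball 0 R) z * ln (cmod (poly r z)))" if "r \<noteq> 0" for r
    by (rule integral_ln_cmod_poly(1)[where H = 1 and R = R])
       (use that in \<open>auto intro: borel_measurable_indicator\<close>)
  from Bochner_Integration.integrable_diff[OF this[OF assms(1)] this[OF assms(2)], THEN integrable_abs]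
  show ?thesis by (simp add: abs_mult flip: right_diff_distrib)
qed

text \<open>A comparison of two root multisets becomes an \<open>L^1\<close> comparison of
  \<open>ln |p|\<close> and \<open>ln |q|\<close>. Zero total mass of \<open>h\<close> removes both
  leading coefficients; no pairing of roots is involved, so the degrees may differ.\<close>

lemma log_potential_diff_proots:
  fixes h :: "complex \<Rightarrow> real" and p q :: "complex poly"
  assumes [measurable]: "h \<in> borel_measurable borel"
    and h: "\<And>z. \<bar>h z\<bar> \<le> H" "\<And>z. R \<le> cmod z \<Longrightarrow> h z = 0" "(\<integral>z. h z \<partial>lborel) = 0"
    and pq: "p \<noteq> 0" "q \<noteq> 0"
  defines "\<phi> \<equiv> \<lambda>x. \<integral>z. h z * ln (cmod (z - x)) \<partial>lborel"
  shows "\<bar>(\<Sum>x\<in>#proots p. \<phi> x) - (\<Sum>x\<in>#proots q. \<phi> x)\<bar>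
    \<le> H * (\<integral>z. indicator (ball 0 R) z * \<bar>ln (cmod (poly p z)) - ln (cmod (poly q z))\<bar> \<partial>lborel)"
proof -
  have I: "integrable lborel (\<lambda>z. h z * ln (cmod (poly r z)))"
    "(\<integral>z. h z * ln (cmod (poly r z)) \<partial>lborel) = (\<Sum>x\<in>#proots r. \<phi> x)" if "r \<noteq> 0" for r
    using integral_ln_cmod_poly[where h = h and H = H and R = R and p = r] h that
    by (auto simp: \<phi>_def)
  have "(\<Sum>x\<in>#proots p. \<phi> x) - (\<Sum>x\<in>#proots q. \<phi> x)
      = (\<integral>z. h z * ln (cmod (poly p z)) \<partial>lborel) - (\<integral>z. h z * ln (cmod (poly q z)) \<partial>lborel)"
    using I(2) pq by simp
  also have "\<dots> = (\<integral>z. h z * ln (cmod (poly p z)) - h z * ln (cmod (poly q z)) \<partial>lborel)"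
    using I(1) pq by simp
  also have "norm \<dots> \<le> (\<integral>z. H * (indicator (ball 0 R) z * \<bar>ln (cmod (poly p z)) - ln (cmod (poly q z))\<bar>) \<partial>lborel)"
  proof (rule Bochner_Integration.integral_norm_bound_integral)
    fix z
    show "norm (h z * ln (cmod (poly p z)) - h z * ln (cmod (poly q z)))
       \<le> H * (indicator (ball 0 R) z * \<bar>ln (cmod (poly p z)) - ln (cmod (poly q z))\<bar>)"
      using h(1)[of z] h(2)[of z]
      by (cases "cmod z < R") (auto simp: abs_mult mult_right_mono simp flip: right_diff_distrib)
  qed (use I(1) pq in \<open>auto intro!: integrable_mult_right integrable_ball_abs_ln_diff\<close>)
  finally show ?thesis by simp
qed

section \<open>Pointwise and integrated bounds for the logarithmic derivative\<close>

definition linear_prod :: "(nat \<Rightarrow> complex) \<Rightarrow> nat set \<Rightarrow> complex poly" where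
  "linear_prod zs I = (\<Prod>i\<in>I. [:- zs i, 1:])"

text \<open>For finite \<open>I\<close>, the logarithmic derivative of
  \<open>linear_prod zs I\<close> off its zeros. At a point \<open>zs i\<close> the corresponding
  summand is \<open>1 / 0 = 0\<close>; such points form a null set.\<close>

definition inv_diff_sum :: "(nat \<Rightarrow> complex) \<Rightarrow> nat set \<Rightarrow> complex \<Rightarrow> complex" where
  "inv_diff_sum zs I z = (\<Sum>i\<in>I. 1 / (z - zs i))"

lemma borel_measurable_inv_diff_sum [measurable]: "inv_diff_sum zs I \<in> borel_measurable borel"
  unfolding inv_diff_sum_def by measurable

locale linear_factors =
  fixes zs :: "nat \<Rightarrow> complex" and I :: "nat set"
  assumes finite_I: "finite I" and I_nonempty: "I \<noteq> {}"
begin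

abbreviation "P \<equiv> linear_prod zs I"

abbreviation "L \<equiv> inv_diff_sum zs I"

lemma P_nonzero: "P \<noteq> 0" and lead_coeff_P: "lead_coeff P = 1" and degree_P: "degree P = card I"
proof -
  show "P \<noteq> 0" using finite_I by (simp add: linear_prod_def)
  show "lead_coeff P = 1" by (simp add: linear_prod_def lead_coeff_prod)
  show "degree P = card I" unfolding linear_prod_def by (subst degree_prod_sum_eq) auto
qed

lemma poly_P: "poly P z = (\<Prod>i\<in>I. (z - zs i))"
  by (simp add: linear_prod_def poly_prod)

lemma proots_P: "proots P = image_mset zs (mset_set I)"
  unfolding linear_prod_def by (subst proots_prod) (auto simp: sum_unfold_sum_mset)

lemma card_I_pos: "0 < card I"
  using finite_I I_nonempty by (simp add: card_gt_0_iff)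

lemma pderiv_P_nonzero: "pderiv P \<noteq> 0" and lead_coeff_pderiv_P: "lead_coeff (pderiv P) = of_nat (card I)"
  and size_proots_pderiv_P: "size (proots (pderiv P)) = card I - 1"
proof -
  show "pderiv P \<noteq> 0" using card_I_pos by (simp add: pderiv_eq_0_iff degree_P)
  show "lead_coeff (pderiv P) = of_nat (card I)"
    using lead_coeff_P card_I_pos by (simp add: degree_pderiv coeff_pderiv degree_P)
  show "size (proots (pderiv P)) = card I - 1"
    by (simp add: size_proots_complex degree_pderiv degree_P)
qed

lemma poly_pderiv_P:
  assumes "poly P z \<noteq> 0"
  shows "poly (pderiv P) z = poly P z * L z"
proof -
  have nz: "z \<noteq> zs i" if "i \<in> I" for i using assms that finite_I by (auto simp: poly_P)
  have "poly (pderiv P) z = (\<Sum>i\<in>I. \<Prod>j\<in>I - {i}. (z - zs j))"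
    by (simp add: linear_prod_def pderiv_prod poly_sum poly_prod pderiv_pCons)
  also have "\<dots> = (\<Sum>i\<in>I. poly P z * (1 / (z - zs i)))"
  proof (rule sum.cong)
    fix i assume i: "i \<in> I"
    have "poly P z = (z - zs i) * (\<Prod>j\<in>I - {i}. (z - zs j))"
      unfolding poly_P using finite_I i by (rule prod.remove)
    then show "(\<Prod>j\<in>I - {i}. (z - zs j)) = poly P z * (1 / (z - zs i))"
      using nz[OF i] by simp
  qed simp
  finally show ?thesis by (simp add: inv_diff_sum_def sum_distrib_left)
qed

text \<open>Factoring out \<open>1 + card I\<close> before using \<open>ln (1 + x) \<le> x\<close>
  leaves the singular sum divided by the number of terms: it integrates to at most one copy of the
  integral of \<open>inv_bump\<close>, and only \<open>ln (1 + card I)\<close> grows.\<close>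

lemma ln_cmod_L_le:
  assumes "L z \<noteq> 0"
  shows "ln (cmod (L z)) \<le> ln (1 + card I) + (\<Sum>i\<in>I. inv_bump (z - zs i)) / (1 + card I)"
proof -
  define S where "S = (\<Sum>i\<in>I. inv_bump (z - zs i))"
  have S: "0 \<le> S" unfolding S_def by (intro sum_nonneg) auto
  have "cmod (L z) \<le> (\<Sum>i\<in>I. 1 + inv_bump (z - zs i))"
    unfolding inv_diff_sum_def
  proof (rule sum_norm_le)
    fix i
    have "1 / cmod w \<le> 1 + inv_bump w" for w
      by (cases "w = 0") (auto simp: inv_bump_def divide_le_eq distrib_right)
    then show "cmod (1 / (z - zs i)) \<le> 1 + inv_bump (z - zs i)" by (simp add: norm_divide)
  qed
  then have "cmod (L z) \<le> 1 + card I + S" by (simp add: sum.distrib S_def)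
  also have "\<dots> = (1 + card I) * (1 + S / (1 + card I))"
    by (simp add: distrib_left)
  finally have "cmod (L z) \<le> (1 + card I) * (1 + S / (1 + card I))" .
  then have "ln (cmod (L z)) \<le> ln ((1 + card I) * (1 + S / (1 + card I)))"
    using assms by (intro ln_mono) auto
  also have "\<dots> = ln (1 + card I) + ln (1 + S / (1 + card I))"
    using S by (intro ln_mult_pos) (auto simp: add_pos_nonneg)
  also have "ln (1 + S / (1 + card I)) \<le> S / (1 + card I)"
    using S by (intro ln_add_one_self_le_self) auto
  finally show ?thesis by (simp add: S_def)
qed

text \<open>The left side is \<open>ln |P| - ln |P'|\<close>. The first term is bounded above
  through the size of the roots, uniformly on the ball; in the second, each critical point costs at
  most \<open>T\<close> plus a singularity of weight \<open>4 / T\<close>, and the leading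
  coefficient \<open>card I\<close> has nonnegative logarithm.\<close>

lemma neg_ln_cmod_L_le:
  assumes P: "poly P z \<noteq> 0" "poly (pderiv P) z \<noteq> 0" and R: "R > 0" "cmod z < R" and T: "T > 0"
  shows "- ln (cmod (L z)) \<le> (\<Sum>i\<in>I. log_plus (cmod (zs i))) + card I * (ln (1 + R) + T)
    + 4 / T * (\<Sum>w\<in>#proots (pderiv P). inv_bump (z - w))"
proof -
  have nz: "z \<noteq> zs i" if "i \<in> I" for i using P(1) that finite_I by (auto simp: poly_P)
  have root: "ln (cmod (z - zs i)) \<le> log_plus (cmod (zs i)) + ln (1 + R)" if "i \<in> I" for i
  proof -
    have "cmod (z - zs i) \<le> R + cmod (zs i)" using norm_triangle_ineq4[of z "zs i"] R by simp
    also have "\<dots> \<le> R * max 1 (cmod (zs i)) + max 1 (cmod (zs i))"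
      using R mult_left_mono[of 1 "max 1 (cmod (zs i))" R] by (intro add_mono) auto
    finally have "ln (cmod (z - zs i)) \<le> ln ((1 + R) * max 1 (cmod (zs i)))"
      using nz[OF that] R by (intro ln_mono) (auto simp: algebra_simps)
    also have "\<dots> = ln (1 + R) + ln (max 1 (cmod (zs i)))" using R by (intro ln_mult_pos) auto
    also have "ln (max 1 (cmod (zs i))) = log_plus (cmod (zs i))"
      by (cases "cmod (zs i) \<ge> 1") (auto simp: log_plus_def max_def)
    finally show ?thesis by simp
  qed
  have "ln (cmod (poly P z)) = (\<Sum>i\<in>I. ln (cmod (z - zs i)))"
    by (simp add: ln_cmod_poly[OF P(1)] lead_coeff_P proots_P image_mset.compositionality o_def sum_unfold_sum_mset)
  also have "\<dots> \<le> (\<Sum>i\<in>I. log_plus (cmod (zs i)) + ln (1 + R))"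
    by (intro sum_mono root)
  finally have up: "ln (cmod (poly P z)) \<le> (\<Sum>i\<in>I. log_plus (cmod (zs i))) + card I * ln (1 + R)"
    by (simp add: sum.distrib)
  have "- (\<Sum>w\<in>#A. ln (cmod (z - w))) \<le> size A * T + 4 / T * (\<Sum>w\<in>#A. inv_bump (z - w))" for A
  proof (induction A)
    case (add w A)
    then show ?case using neg_ln_cmod_le[OF T, of "z - w"] by (simp add: algebra_simps)
  qed simp
  then have "- (\<Sum>w\<in>#proots (pderiv P). ln (cmod (z - w)))
      \<le> (card I - 1) * T + 4 / T * (\<Sum>w\<in>#proots (pderiv P). inv_bump (z - w))"
    using size_proots_pderiv_P by metis
  moreover have "real (card I - 1) * T \<le> card I * T" using T by (intro mult_right_mono) auto
  moreover have "ln (cmod (poly (pderiv P) z))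
      = ln (card I) + (\<Sum>w\<in>#proots (pderiv P). ln (cmod (z - w)))"
    by (simp add: ln_cmod_poly[OF P(2)] lead_coeff_pderiv_P)
  moreover have "0 \<le> ln (card I)" using card_I_pos by simp
  moreover have "ln (cmod (poly (pderiv P) z)) = ln (cmod (poly P z)) + ln (cmod (L z))"
    using P poly_pderiv_P[OF P(1)] by (simp add: norm_mult ln_mult)
  ultimately show ?thesis using up by (simp add: algebra_simps)
qed

text \<open>The costly bound for the negative part carries the indicator of the set where
  \<open>L\<close> is tiny; elsewhere \<open>card I * \<delta>\<close> suffices. The singular sum
  over critical points stays outside the indicator, since a large \<open>T\<close> makes its
  integral over the whole plane small compared with \<open>card I\<close>.\<close>

lemma abs_ln_diff_le:
  fixes \<delta> :: real
  assumes P: "poly P z \<noteq> 0" "poly (pderiv P) z \<noteq> 0" and R: "R > 0" "cmod z < R"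
    and T: "T > 0" and d: "\<delta> > 0"
  shows "\<bar>ln (cmod (poly (pderiv P) z)) - ln (cmod (poly P z))\<bar>
    \<le> ln (1 + card I) + (\<Sum>i\<in>I. inv_bump (z - zs i)) / (1 + card I) + card I * \<delta>
      + of_bool (cmod (L z) \<le> exp (- \<delta> * card I))
          * ((\<Sum>i\<in>I. log_plus (cmod (zs i))) + card I * (ln (1 + R) + T))
      + 4 / T * (\<Sum>w\<in>#proots (pderiv P). inv_bump (z - w))"
proof -
  have L: "L z \<noteq> 0" using P poly_pderiv_P[OF P(1)] by auto
  have eq: "ln (cmod (poly (pderiv P) z)) - ln (cmod (poly P z)) = ln (cmod (L z))"
    using P poly_pderiv_P[OF P(1)] by (simp add: norm_mult ln_mult)
  have "0 \<le> (\<Sum>w\<in>#A. inv_bump (z - w))" for A by (induction A) auto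
  then have q: "0 \<le> 4 / T * (\<Sum>w\<in>#A. inv_bump (z - w))" for A using T by simp
  have S: "0 \<le> (\<Sum>i\<in>I. inv_bump (z - zs i)) / (1 + card I)"
    by (intro divide_nonneg_nonneg sum_nonneg) auto
  have lp: "0 \<le> (\<Sum>i\<in>I. log_plus (cmod (zs i)))" by (intro sum_nonneg) (auto simp: log_plus_def)
  have "0 \<le> card I * (ln (1 + R) + T)" using R T by (intro mult_nonneg_nonneg add_nonneg_nonneg) auto
  with lp have b: "0 \<le> of_bool (cmod (L z) \<le> exp (- \<delta> * card I))
          * ((\<Sum>i\<in>I. log_plus (cmod (zs i))) + card I * (ln (1 + R) + T))" by simp
  have ln0: "0 \<le> ln (real (1 + card I))" "0 \<le> card I * \<delta>" using d by auto
  show ?thesis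
  proof (cases "cmod (L z) \<le> exp (- \<delta> * card I)")
    case True
    then show ?thesis unfolding eq
      using ln_cmod_L_le[OF L] neg_ln_cmod_L_le[OF P R T] q[of "proots (pderiv P)"] S b ln0
      unfolding abs_le_iff by (simp only: of_bool_eq mult_1) (intro conjI; linarith)
  next
    case False
    then have "exp (- \<delta> * card I) < cmod (L z)" by simp
    then have "ln (exp (- \<delta> * card I)) < ln (cmod (L z))" by (intro ln_less_cancel_iff[THEN iffD2]) auto
    then have "- ln (cmod (L z)) \<le> card I * \<delta>" by (simp add: mult.commute)
    then show ?thesis unfolding eq
      using ln_cmod_L_le[OF L] q[of "proots (pderiv P)"] S b ln0 unfolding abs_le_iff by linarith
  qed
qed

lemma integral_abs_ln_diff_le:
  fixes \<delta> :: real
  assumes R: "R > 0" and T: "T > 0" and d: "\<delta> > 0"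
  defines "V \<equiv> measure lborel (ball (0::complex) R)" and "J \<equiv> \<integral>z. inv_bump z \<partial>lborel"
  shows "(\<integral>z. indicator (ball 0 R) z * \<bar>ln (cmod (poly (pderiv P) z)) - ln (cmod (poly P z))\<bar> \<partial>lborel)
    \<le> V * ln (1 + card I) + J + V * (card I * \<delta>)
      + ((\<Sum>i\<in>I. log_plus (cmod (zs i))) + card I * (ln (1 + R) + T))
          * (\<integral>z. indicator (ball 0 R) z * of_bool (cmod (L z) \<le> exp (- \<delta> * card I)) \<partial>lborel)
      + 4 / T * card I * J"
proof -
  define K where "K = (\<Sum>i\<in>I. log_plus (cmod (zs i))) + card I * (ln (1 + R) + T)"
  define b where "b z = indicator (ball 0 R) z * (of_bool (cmod (L z) \<le> exp (- \<delta> * card I)) :: real)" for z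
  define S where "S z = (\<Sum>i\<in>I. inv_bump (z - zs i))" for z
  define Q where "Q z = (\<Sum>w\<in>#proots (pderiv P). inv_bump (z - w))" for z
  have [measurable]: "ball (0::complex) R \<in> sets borel" by simp
  have iB: "integrable lborel (indicat_real (ball (0::complex) R))"
    by (rule integrable_real_indicator) (auto intro: emeasure_lborel_ball_finite[unfolded infinity_ennreal_def])
  have ib: "integrable lborel b"
    unfolding b_def by (rule Bochner_Integration.integrable_bound[OF iB]) auto
  have iS: "integrable lborel S" unfolding S_def by (intro Bochner_Integration.integrable_sum integrable_inv_bump_diff)
  have iQ: "integrable lborel Q" unfolding Q_def by (intro integral_sum_mset integrable_inv_bump_diff)
  have J0: "0 \<le> J" unfolding J_def by (intro integral_nonneg_AE) auto
  have eS: "(\<integral>z. S z \<partial>lborel) = card I * J"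
    unfolding S_def J_def by (simp add: integrable_inv_bump_diff integral_inv_bump_diff)
  have eQ: "(\<integral>z. Q z \<partial>lborel) = real (card I - 1) * J"
    unfolding Q_def J_def
    by (simp add: integral_sum_mset[OF integrable_inv_bump_diff] integral_inv_bump_diff size_proots_pderiv_P)
  have "(\<integral>z. indicator (ball 0 R) z * \<bar>ln (cmod (poly (pderiv P) z)) - ln (cmod (poly P z))\<bar> \<partial>lborel)
    \<le> (\<integral>z. ln (1 + card I) * indicator (ball 0 R) z + S z / (1 + card I) + card I * \<delta> * indicator (ball 0 R) z
        + K * b z + 4 / T * Q z \<partial>lborel)"
  proof (rule integral_mono_AE)
    show "AE z in lborel. indicator (ball 0 R) z * \<bar>ln (cmod (poly (pderiv P) z)) - ln (cmod (poly P z))\<bar>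
      \<le> ln (1 + card I) * indicator (ball 0 R) z + S z / (1 + card I) + card I * \<delta> * indicator (ball 0 R) z
        + K * b z + 4 / T * Q z"
      using AE_poly_neq_0[OF P_nonzero] AE_poly_neq_0[OF pderiv_P_nonzero]
    proof eventually_elim
      case (elim z)
      have "0 \<le> (\<Sum>w\<in>#A. inv_bump (z - w))" for A by (induction A) auto
      then have "0 \<le> 4 / T * Q z" using T by (simp add: Q_def)
      moreover have "0 \<le> S z / (1 + card I)" unfolding S_def
        by (intro divide_nonneg_nonneg sum_nonneg) auto
      ultimately show ?case
      proof (cases "cmod z < R")
        case True
        then show ?thesis using abs_ln_diff_le[OF elim R True T d]
          by (simp add: b_def S_def Q_def K_def mult_ac)
      qed (simp add: b_def)
    qed
  qed (use iB iS ib iQ P_nonzero pderiv_P_nonzero in \<open>auto intro!: integrable_ball_abs_ln_diff\<close>)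
  also have "\<dots> = V * ln (1 + card I) + card I * J / (1 + card I) + V * (card I * \<delta>)
      + K * (\<integral>z. b z \<partial>lborel) + 4 / T * (real (card I - 1) * J)"
    using iB iS ib iQ by (simp add: eS eQ V_def mult_ac)
  also have "card I * J / (1 + card I) \<le> J" using J0 by (simp add: field_simps)
  also have "4 / T * (real (card I - 1) * J) \<le> 4 / T * card I * J"
    using J0 T by (simp add: mult_right_mono divide_right_mono)
  finally show ?thesis by (simp add: K_def b_def)
qed

end

section \<open>Equidistributed sequences\<close>

lemma integral_uniform_on_mset:
  fixes f :: "complex \<Rightarrow> real"
  assumes "A \<noteq> {#}" and [measurable]: "f \<in> borel_measurable borel"
  shows "integral\<^sup>L (uniform_on_mset A) f = (\<Sum>x\<in>#A. f x) / size A"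
proof -
  \<comment> \<open>The index set \<open>S\<close> stays fixed while the multiset grows; with
    \<open>set_mset B\<close> in its place the range of summation would change during the
    induction.\<close>
  have "(\<Sum>x\<in>#B. f x) = (\<Sum>x\<in>S. f x * count B x)" if "finite S" "set_mset B \<subseteq> S" for B S
    using that(2)
  proof (induction B)
    case (add y B)
    have "(\<Sum>x\<in>S. f x * count (add_mset y B) x) = (\<Sum>x\<in>S. f x * count B x + (if x = y then f x else 0))"
      by (intro sum.cong) (auto simp: distrib_left)
    then show ?case using add that(1) by (simp add: sum.distrib)
  qed simp
  from this[of "set_mset A" A] have "(\<Sum>x\<in>#A. f x) = (\<Sum>x\<in>set_mset A. f x * count A x)" by simp
  moreover have "(\<integral>x. f x \<partial>measure_pmf (pmf_of_multiset A)) = (\<Sum>x\<in>set_mset A. f x * pmf (pmf_of_multiset A) x)"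
    by (rule integral_measure_pmf_real) (use assms in auto)
  ultimately show ?thesis using assms(1)
    by (simp add: uniform_on_mset_def integral_distr sum_divide_distrib)
qed

lemma uniform_on_mset_in_borel_probs: "uniform_on_mset A \<in> borel_probs"
  by (auto simp: borel_probs_def uniform_on_mset_def intro!: measure_pmf.prob_space_distr)

lemma mu_distributed_tendsto:
  fixes f :: "complex \<Rightarrow> real"
  assumes "mu_distributed \<mu> z" and f: "continuous_on UNIV f" "bounded (range f)"
  shows "(\<lambda>n. (\<Sum>i<n. f (z i)) / n) \<longlonglongrightarrow> integral\<^sup>L \<mu> f"
proof -
  have [measurable]: "f \<in> borel_measurable borel" by (rule borel_measurable_continuous_onI[OF f(1)])
  have "(\<lambda>n. integral\<^sup>L (empirical_measure z n) f) \<longlonglongrightarrow> integral\<^sup>L \<mu> f"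
    using assms by (auto simp: mu_distributed_def limitin_weak_topology_iff)
  moreover have "integral\<^sup>L (empirical_measure z n) f = (\<Sum>i<n. f (z i)) / n" if "n > 0" for n
  proof -
    have "mset_set {..<n} \<noteq> {#}" using that by (auto simp: mset_set_empty_iff lessThan_empty_iff)
    then show ?thesis unfolding empirical_measure_def
      by (subst integral_uniform_on_mset)
         (auto simp: image_mset.compositionality o_def sum_unfold_sum_mset)
  qed
  then have "\<forall>\<^sub>F n in sequentially. integral\<^sup>L (empirical_measure z n) f = (\<Sum>i<n. f (z i)) / n"
    by (intro eventually_sequentiallyI[of 1]) auto
  ultimately show ?thesis by (simp add: tendsto_cong)
qed

locale equidistributed = prob_space \<mu> for \<mu> :: "complex measure" +
  fixes z :: "nat \<Rightarrow> complex"
  assumes sets_mu [measurable_cong]: "sets \<mu> = sets borel"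
    and distributed: "mu_distributed \<mu> z"
begin

lemma space_mu [simp]: "space \<mu> = UNIV"
  using sets_eq_imp_space_eq[OF sets_mu] by simp

lemma integrable_mu:
  fixes f :: "complex \<Rightarrow> real"
  assumes "f \<in> borel_measurable borel" "bounded (range f)"
  shows "integrable \<mu> f"
proof -
  obtain C where "\<And>x. \<bar>f x\<bar> \<le> C" using assms(2) by (auto simp: bounded_iff)
  then show ?thesis by (intro integrable_const_bound[of _ C]) (use assms(1) in \<open>auto simp: measurable_cong_sets[OF sets_mu refl]\<close>)
qed

text \<open>The part of the portmanteau theorem used here: indicators are not continuous, so a
  continuous \<open>f\<close> is placed between those of \<open>S\<close> and of the larger set
  \<open>T\<close>.\<close>

lemma eventually_card_le:
  fixes f :: "complex \<Rightarrow> real" and e :: real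
  assumes f: "continuous_on UNIV f" "\<And>x. x \<in> S \<Longrightarrow> f x = 1" "\<And>x. 0 \<le> f x" "\<And>x. f x \<le> indicator T x"
    and T: "T \<in> sets borel" "measure \<mu> T < e"
  shows "\<forall>\<^sub>F n in sequentially. card {i. i < n \<and> z i \<in> S} \<le> e * n"
proof -
  have [measurable]: "f \<in> borel_measurable borel" by (rule borel_measurable_continuous_onI[OF f(1)])
  have "f x \<le> 1" for x using f(4)[of x] by (auto simp: indicator_def split: if_splits intro: order.trans)
  then have bd: "bounded (range f)" using f(3) by (auto simp: bounded_iff intro!: exI[of _ 1])
  have "integral\<^sup>L \<mu> f \<le> (\<integral>x. indicator T x \<partial>\<mu>)"
  proof (rule integral_mono)
    show "integrable \<mu> f" by (rule integrable_mu) (use bd in auto)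
    show "integrable \<mu> (indicat_real T)"
      by (rule integrable_mu) (use T in \<open>auto simp: bounded_iff indicator_def intro!: exI[of _ "1::real"]\<close>)
  qed (use f(4) in auto)
  also have "\<dots> < e" using T by simp
  finally have "\<forall>\<^sub>F n in sequentially. (\<Sum>i<n. f (z i)) / n < e"
    using order_tendstoD(2)[OF mu_distributed_tendsto[OF distributed f(1) bd]] by blast
  then show ?thesis using eventually_gt_at_top[of 0]
  proof eventually_elim
    case (elim n)
    have "real (card {i. i < n \<and> z i \<in> S}) = (\<Sum>i\<in>{i. i < n \<and> z i \<in> S}. f (z i))"
      using f(2) by simp
    also have "\<dots> \<le> (\<Sum>i<n. f (z i))" by (rule sum_mono2) (use f(3) in auto)
    also have "\<dots> \<le> e * n" using elim by (simp add: field_simps)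
    finally show ?case .
  qed
qed

text \<open>A single probability measure on the plane is tight, and weak convergence passes this on
  to the sequence. The cutoff rises from 0 to 1 over one unit, whence \<open>R + 1\<close> in the
  frequency bound.\<close>

lemma tight:
  fixes e :: real
  assumes e: "e > 0"
  obtains R where "R > 0" "measure \<mu> {x. R < cmod x} < e"
    "\<forall>\<^sub>F n in sequentially. card {i. i < n \<and> R + 1 \<le> cmod (z i)} \<le> e * n"
proof -
  have "(\<lambda>k. measure \<mu> {x. real k < cmod x}) \<longlonglongrightarrow> measure \<mu> (\<Inter>k. {x. real k < cmod x})"
    by (rule finite_Lim_measure_decseq) (auto simp: decseq_def)
  moreover have "(\<Inter>k. {x::complex. real k < cmod x}) = {}"
    by (auto simp: set_eq_iff not_less intro: less_imp_le reals_Archimedean2[THEN exE])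
  ultimately have "(\<lambda>k. measure \<mu> {x. real k < cmod x}) \<longlonglongrightarrow> 0" by simp
  from order_tendstoD(2)[OF this e] obtain k where k: "measure \<mu> {x. real k < cmod x} < e"
    by (auto simp: eventually_sequentially)
  define R where "R = real k + 1"
  have "measure \<mu> {x. R < cmod x} \<le> measure \<mu> {x. real k < cmod x}"
    by (rule finite_measure_mono) (auto simp: R_def)
  then have R: "measure \<mu> {x. R < cmod x} < e" using k by simp
  define f where "f x = max 0 (min 1 (cmod x - R))" for x :: complex
  have "\<forall>\<^sub>F n in sequentially. card {i. i < n \<and> z i \<in> {x. R + 1 \<le> cmod x}} \<le> e * n"
  proof (rule eventually_card_le[of f _ "{x. R < cmod x}"])
    show "continuous_on UNIV f" unfolding f_def by (intro continuous_intros)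
  qed (use R in \<open>auto simp: f_def indicator_def\<close>)
  then show ?thesis using that[of R] R by (simp add: R_def)
qed

end

section \<open>Frequencies in small balls\<close>

locale equidistributed_non_atomic = equidistributed +
  assumes non_atomic: "non_atomic \<mu>"
begin

text \<open>This is where non-atomicity enters: balls shrinking to \<open>p\<close> have mass
  tending to that of the point, which is 0. Controlling the mass at radius \<open>2 * r\<close>
  leaves room for a cutoff equal to 1 on \<open>ball p r\<close>.\<close>

lemma eventually_card_ball_le:
  fixes e :: real
  assumes e: "e > 0"
  obtains r where "r > 0"
    "\<forall>\<^sub>F n in sequentially. card {i. i < n \<and> z i \<in> ball p r} \<le> e * n"
proof -
  have "(\<lambda>k. measure \<mu> (ball p (2 / Suc k))) \<longlonglongrightarrow> measure \<mu> (\<Inter>k. ball p (2 / Suc k))"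
  proof (rule finite_Lim_measure_decseq)
    have "2 / real (Suc n) \<le> 2 / real (Suc m)" if "m \<le> n" for m n
      using that by (intro frac_le) auto
    then show "decseq (\<lambda>k. ball p (2 / Suc k))"
      unfolding decseq_def by (intro allI impI subset_ball)
  qed auto
  moreover have "(\<Inter>k. ball p (2 / Suc k)) = {p}"
  proof (intro equalityI subsetI)
    fix x assume x: "x \<in> (\<Inter>k. ball p (2 / Suc k))"
    have "dist p x \<le> 0"
    proof (rule tendsto_lowerbound)
      show "(\<lambda>k. 2 / real (Suc k)) \<longlonglongrightarrow> 0" by real_asymp
      show "\<forall>\<^sub>F k in sequentially. dist p x \<le> 2 / real (Suc k)"
        using x by (intro always_eventually) (auto intro: less_imp_le)
    qed simp
    then show "x \<in> {p}" by simp
  qed auto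
  moreover have "measure \<mu> {p} = 0" using non_atomic by (simp add: non_atomic_def measure_def)
  ultimately have "(\<lambda>k. measure \<mu> (ball p (2 / Suc k))) \<longlonglongrightarrow> 0" by simp
  from order_tendstoD(2)[OF this e] obtain k where k: "measure \<mu> (ball p (2 / Suc k)) < e"
    by (auto simp: eventually_sequentially)
  define r where "r = 1 / real (Suc k)"
  have r: "r > 0" "measure \<mu> (ball p (2 * r)) < e" using k by (auto simp: r_def)
  define f where "f x = max 0 (min 1 (2 - dist p x / r))" for x
  have "\<forall>\<^sub>F n in sequentially. card {i. i < n \<and> z i \<in> ball p r} \<le> e * n"
  proof (rule eventually_card_le[of f _ "ball p (2 * r)"])
    show "continuous_on UNIV f" unfolding f_def by (intro continuous_intros) (use r in auto)
  qed (use r in \<open>auto simp: f_def indicator_def field_simps\<close>)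
  then show ?thesis using that r by blast
qed

text \<open>The centre will be one of the points and change with \<open>n\<close>, so one radius has
  to serve all centres. By compactness, finitely many balls of radius \<open>\<rho> p / 2\<close>
  cover the disc; a ball whose radius is at most \<open>\<rho> p / 2\<close> and whose centre lies
  in such a ball stays within \<open>ball p (\<rho> p)\<close>.\<close>

lemma eventually_card_small_balls_le:
  fixes e :: real
  assumes e: "e > 0"
  obtains r where "r > 0"
    "\<forall>\<^sub>F n in sequentially. \<forall>w\<in>cball 0 R. card {i. i < n \<and> z i \<in> ball w r} \<le> e * n"
proof -
  have "\<exists>r. r > 0 \<and> (\<forall>\<^sub>F n in sequentially. card {i. i < n \<and> z i \<in> ball p r} \<le> e * n)" for p
    by (rule eventually_card_ball_le[OF e, of p]) blast
  then have "\<exists>\<rho>. \<forall>p. \<rho> p > 0 \<and> (\<forall>\<^sub>F n in sequentially. card {i. i < n \<and> z i \<in> ball p (\<rho> p)} \<le> e * n)"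
    by (intro choice allI)
  then obtain \<rho> where \<rho>: "\<And>p. \<rho> p > 0"
    "\<And>p. \<forall>\<^sub>F n in sequentially. card {i. i < n \<and> z i \<in> ball p (\<rho> p)} \<le> e * n"
    by blast
  have cov: "cball (0::complex) R \<subseteq> (\<Union>p\<in>cball 0 R. ball p (\<rho> p / 2))"
    using \<rho>(1) by (intro subsetI UN_I) auto
  obtain C where C: "C \<subseteq> cball 0 R" "finite C" "cball 0 R \<subseteq> (\<Union>p\<in>C. ball p (\<rho> p / 2))"
    by (rule compactE_image[OF compact_cball _ cov])
       (rule open_ball, rule that)
  \<comment> \<open>The extra element 1 keeps \<open>Min\<close> meaningful when the cover is empty,
    as for negative \<open>R\<close>.\<close>
  define r where "r = Min (insert 1 ((\<lambda>p. \<rho> p / 2) ` C))"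
  have r: "r > 0" "\<And>p. p \<in> C \<Longrightarrow> r \<le> \<rho> p / 2"
  proof -
    show "r > 0" using C(2) \<rho>(1) by (auto simp: r_def)
    show "r \<le> \<rho> p / 2" if "p \<in> C" for p
      unfolding r_def using C(2) that by (intro Min_le) auto
  qed
  have "\<forall>\<^sub>F n in sequentially. \<forall>p\<in>C. card {i. i < n \<and> z i \<in> ball p (\<rho> p)} \<le> e * n"
    using C(2) \<rho>(2) by (intro eventually_ball_finite) auto
  then have "\<forall>\<^sub>F n in sequentially. \<forall>w\<in>cball 0 R. card {i. i < n \<and> z i \<in> ball w r} \<le> e * n"
  proof eventually_elim
    case (elim n)
    show ?case
    proof
      fix w :: complex assume "w \<in> cball 0 R"
      then obtain p where p: "p \<in> C" "dist p w < \<rho> p / 2" using C(3) by auto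
      have "ball w r \<subseteq> ball p (\<rho> p)"
      proof
        fix x assume "x \<in> ball w r"
        then show "x \<in> ball p (\<rho> p)" using dist_triangle[of p x w] p r(2)[OF p(1)] by simp
      qed
      then have "card {i. i < n \<and> z i \<in> ball w r} \<le> card {i. i < n \<and> z i \<in> ball p (\<rho> p)}"
        by (intro card_mono) auto
      also have "real \<dots> \<le> e * n" using elim p by auto
      finally show "real (card {i. i < n \<and> z i \<in> ball w r}) \<le> e * n" by simp
    qed
  qed
  then show ?thesis using that r(1) by blast
qed

section \<open>Indices whose removal leaves a tiny logarithmic derivative\<close>

definition cancelling :: "real \<Rightarrow> nat \<Rightarrow> complex \<Rightarrow> nat set" where
  "cancelling \<delta> n w = {k. k \<le> n \<and> cmod (inv_diff_sum z ({..n} - {k}) w) \<le> exp (- \<delta> * n)}"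

text \<open>
  If \<open>k\<close> and \<open>l\<close> are both cancelling then \<open>1 / (w - z k)\<close> and \<open>1 / (w - z l)\<close> are both
  exponentially close to the full sum, hence to each other, so that all cancelling \<open>z k\<close> in a bounded
  region lie in one tiny ball.
\<close>
lemma cancelling_density_tendsto_0:
  assumes w: "w \<notin> range z" and d: "\<delta> > 0"
  shows "(\<lambda>n. card (cancelling \<delta> n w) / (n + 1)) \<longlonglongrightarrow> 0"
proof (rule order_tendstoI)
  fix e :: real assume e: "0 < e"
  obtain R where R: "R > 0"
    "\<forall>\<^sub>F n in sequentially. card {i. i < n \<and> R + 1 \<le> cmod (z i)} \<le> e / 3 * n"
    using tight[of "e / 3"] e by auto
  obtain r where r: "r > 0"
    "\<forall>\<^sub>F n in sequentially. \<forall>p\<in>cball 0 (R + 1). card {i. i < n \<and> z i \<in> ball p r} \<le> e / 3 * n"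
    using eventually_card_small_balls_le[of "e / 3" "R + 1"] e by auto
  \<comment> \<open>The factor \<open>2 * exp (- \<delta> * n)\<close> bounds a difference of two
    reciprocals; the square bounds the product of denominators that converts it into a difference of
    points.\<close>
  have "(\<lambda>n. 2 * exp (- \<delta> * real n) * (cmod w + R + 1)\<^sup>2) \<longlonglongrightarrow> 0"
    using d by real_asymp
  from order_tendstoD(2)[OF this r(1)]
  have ev: "\<forall>\<^sub>F n in sequentially. 2 * exp (- \<delta> * real n) * (cmod w + R + 1)\<^sup>2 < r" .
  \<comment> \<open>The sum over \<open>{..n}\<close> has \<open>n + 1\<close> terms, whereas the
    frequency bounds count indices below their argument; hence the shift by
    \<open>Suc\<close>.\<close>
  show "\<forall>\<^sub>F n in sequentially. card (cancelling \<delta> n w) / (n + 1) < e"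
    using ev eventually_compose_filterlim[OF R(2) filterlim_Suc] eventually_compose_filterlim[OF r(2) filterlim_Suc]
  proof eventually_elim
    case (elim n)
    \<comment> \<open>Far points are counted separately: for them, close reciprocals do not mean
      close points. Two shares of \<open>e / 3\<close> keep the total strictly below
      \<open>e\<close>.\<close>
    define X where "X = {i. i < Suc n \<and> R + 1 \<le> cmod (z i)}"
    define Y where "Y = {k \<in> cancelling \<delta> n w. cmod (z k) < R + 1}"
    have fin: "finite X" "finite Y" by (auto simp: X_def Y_def cancelling_def)
    have "cancelling \<delta> n w \<subseteq> X \<union> Y" by (auto simp: X_def Y_def cancelling_def)
    then have "card (cancelling \<delta> n w) \<le> card X + card Y"
      using card_mono[of "X \<union> Y"] card_Un_le[of X Y] fin by (meson finite_UnI order.trans)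
    moreover have "card X \<le> e / 3 * Suc n" using elim(2) by (simp add: X_def)
    moreover have "card Y \<le> e / 3 * Suc n"
    proof (cases "Y = {}")
      case False
      then obtain l where l: "l \<in> Y" by blast
      have close: "z k \<in> ball (z l) r" if k: "k \<in> Y" for k
      proof -
        have nz: "w \<noteq> z i" for i using w by auto
        define S where "S = (\<Sum>i\<le>n. 1 / (w - z i))"
        have near: "cmod (S - 1 / (w - z i)) \<le> exp (- \<delta> * n)" if "i \<in> Y" for i
        proof -
          have i: "i \<le> n" "cmod (inv_diff_sum z ({..n} - {i}) w) \<le> exp (- \<delta> * n)"
            using that by (auto simp: Y_def cancelling_def)
          have "S = 1 / (w - z i) + (\<Sum>j\<in>{..n} - {i}. 1 / (w - z j))"
            unfolding S_def using i(1) by (intro sum.remove) auto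
          then show ?thesis using i(2) by (simp add: inv_diff_sum_def)
        qed
        have "1 / (w - z k) - 1 / (w - z l) = (S - 1 / (w - z l)) - (S - 1 / (w - z k))" by simp
        also have "cmod \<dots> \<le> 2 * exp (- \<delta> * n)"
          using norm_triangle_ineq4[of "S - 1 / (w - z l)" "S - 1 / (w - z k)"] near[OF l] near[OF k] by linarith
        finally have diff: "cmod (1 / (w - z k) - 1 / (w - z l)) \<le> 2 * exp (- \<delta> * n)" .
        have le: "cmod (w - z i) \<le> cmod w + R + 1" if "i \<in> Y" for i
          using norm_triangle_ineq4[of w "z i"] that by (auto simp: Y_def)
        have "z k - z l = (1 / (w - z k) - 1 / (w - z l)) * ((w - z k) * (w - z l))"
          using nz[of k] nz[of l] by (simp add: divide_simps)
        then have "cmod (z k - z l) = cmod (1 / (w - z k) - 1 / (w - z l)) * (cmod (w - z k) * cmod (w - z l))"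
          by (simp only: norm_mult)
        also have "\<dots> \<le> 2 * exp (- \<delta> * n) * ((cmod w + R + 1) * (cmod w + R + 1))"
          by (intro mult_mono diff le k l) (use R in auto)
        also have "\<dots> < r" using elim(1) by (simp add: power2_eq_square)
        finally show ?thesis by (simp add: dist_norm norm_minus_commute)
      qed
      have "z l \<in> cball 0 (R + 1)" using l by (auto simp: Y_def)
      then have "card {i. i < Suc n \<and> z i \<in> ball (z l) r} \<le> e / 3 * Suc n" using elim(3) by blast
      moreover have "card Y \<le> card {i. i < Suc n \<and> z i \<in> ball (z l) r}"
        by (intro card_mono) (use close in \<open>auto simp: Y_def cancelling_def\<close>)
      ultimately show ?thesis by linarith
    qed (use e in auto)
    ultimately have "real (card (cancelling \<delta> n w)) \<le> e / 3 * Suc n + e / 3 * Suc n" by linarith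
    also have "\<dots> = 2 / 3 * (e * Suc n)" by simp
    also have "\<dots> < 1 * (e * Suc n)" using e by (intro mult_strict_right_mono) auto
    finally show ?case by (simp add: field_simps)
  qed
next
  fix e :: real assume "e < 0"
  then have "e < real (card (cancelling \<delta> n w)) / real (n + 1)" for n
    by (rule less_le_trans) auto
  then show "\<forall>\<^sub>F n in sequentially. e < card (cancelling \<delta> n w) / (n + 1)"
    by (intro always_eventually allI)
qed

section \<open>The \<open>L^1\<close> distance of \<open>ln |P'|\<close> and \<open>ln |P|\<close>,
  averaged over the removed index\<close>

definition ln_gap :: "real \<Rightarrow> nat \<Rightarrow> nat \<Rightarrow> real" where
  "ln_gap R n k = (\<integral>x. indicator (ball 0 R) x *
      \<bar>ln (cmod (poly (pderiv (linear_prod z ({..n} - {k}))) x)) - ln (cmod (poly (linear_prod z ({..n} - {k})) x))\<bar> \<partial>lborel)"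

lemma ln_gap_nonneg: "0 \<le> ln_gap R n k"
  unfolding ln_gap_def by (intro integral_nonneg_AE) auto

text \<open>As a sum of indicators the count is visibly measurable in \<open>w\<close>, and its
  integral over a ball is a sum over \<open>k\<close> of areas.\<close>

lemma card_cancelling: "real (card (cancelling \<delta> n w))
    = (\<Sum>k\<le>n. of_bool (cmod (inv_diff_sum z ({..n} - {k}) w) \<le> exp (- \<delta> * n)))"
  by (simp add: cancelling_def of_bool_def sum.If_cases Int_def)

text \<open>Dominated convergence on the ball, the densities being at most 1; pointwise convergence
  is known off the countable set of the points \<open>z i\<close>.\<close>

lemma integral_cancelling_density_tendsto_0:
  assumes d: "\<delta> > 0"
  shows "(\<lambda>n. \<integral>x. indicator (ball 0 R) x * (card (cancelling \<delta> n x) / (n + 1)) \<partial>lborel) \<longlonglongrightarrow> 0"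
proof -
  have [measurable]: "ball (0::complex) R \<in> sets borel" by simp
  define s :: "nat \<Rightarrow> complex \<Rightarrow> real" where "s n x = indicator (ball 0 R) x * (card (cancelling \<delta> n x) / (n + 1))" for n x
  have "(\<lambda>n. \<integral>x. s n x \<partial>lborel) \<longlonglongrightarrow> (\<integral>x. 0 \<partial>(lborel :: complex measure))"
  proof (rule integral_dominated_convergence[where w = "indicator (ball 0 R)"])
    show "s n \<in> borel_measurable lborel" for n
      unfolding card_cancelling s_def by measurable
    show "integrable lborel (indicat_real (ball (0::complex) R))"
      by (rule integrable_real_indicator) (auto intro: emeasure_lborel_ball_finite[unfolded infinity_ennreal_def])
    have "countable (range z)" by simp
    then have "range z \<in> null_sets lborel" by (rule countable_imp_null_set_lborel)
    then show "AE x in lborel. (\<lambda>n. s n x) \<longlonglongrightarrow> 0"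
      unfolding s_def by (rule AE_not_in[THEN eventually_mono])
         (rule tendsto_mult_right_zero, use cancelling_density_tendsto_0 d in \<open>simp add: add.commute\<close>)
    have "card (cancelling \<delta> n x) \<le> n + 1" for n x
      using card_mono[of "{..n}" "cancelling \<delta> n x"] by (auto simp: cancelling_def)
    from of_nat_mono[OF this] have "real (card (cancelling \<delta> n x)) / (n + 1) \<le> 1" for n x
      by (simp add: divide_le_eq add.commute)
    then show "AE x in lborel. norm (s n x) \<le> indicator (ball 0 R) x" for n
      unfolding s_def by (intro AE_I2) (auto simp: indicator_def add.commute)
  qed auto
  then show ?thesis by (simp add: s_def add.commute)
qed

text \<open>Summing over \<open>k\<close> before integrating turns the areas of the bad sets into
  the integral of the cancelling density; all other terms are bounded uniformly in
  \<open>k\<close>.\<close>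

lemma sum_ln_gap_le:
  fixes \<delta> T R A :: real
  assumes A: "\<And>m. m \<ge> 1 \<Longrightarrow> (\<Sum>i<m. log_plus (cmod (z i))) \<le> A * m" and n: "n \<ge> 1"
    and pos: "\<delta> > 0" "T > 0" "R > 0"
  defines "V \<equiv> measure lborel (ball (0::complex) R)" and "J \<equiv> \<integral>z. inv_bump z \<partial>lborel"
  shows "(\<Sum>k\<le>n. ln_gap R n k) / (real n * (n + 1))
    \<le> V * (ln (1 + n) / n) + J / n + V * \<delta> + 4 / T * J
      + (2 * A + ln (1 + R) + T) * (\<integral>x. indicator (ball 0 R) x * (card (cancelling \<delta> n x) / (n + 1)) \<partial>lborel)"
proof -
  have [measurable]: "ball (0::complex) R \<in> sets borel" by simp
  define b where "b k x = indicator (ball 0 R) x *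
      (of_bool (cmod (inv_diff_sum z ({..n} - {k}) x) \<le> exp (- \<delta> * n)) :: real)" for k x
  define K where "K = 2 * A + ln (1 + R) + T"
  have iB: "integrable lborel (indicat_real (ball (0::complex) R))"
    by (rule integrable_real_indicator) (auto intro: emeasure_lborel_ball_finite[unfolded infinity_ennreal_def])
  have ib: "integrable lborel (b k)" for k
    unfolding b_def by (rule Bochner_Integration.integrable_bound[OF iB]) auto
  have b0: "0 \<le> (\<integral>x. b k x \<partial>lborel)" for k
    by (intro integral_nonneg_AE) (auto simp: b_def)
  have gap: "ln_gap R n k \<le> (V * ln (1 + n) + J + V * (n * \<delta>) + 4 / T * n * J) + n * K * (\<integral>x. b k x \<partial>lborel)"
    if k: "k \<le> n" for k
  proof -
    have "(if k = 0 then 1 else 0) \<in> {..n} - {k}" using n by auto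
    then interpret linear_factors z "{..n} - {k}" by unfold_locales auto
    have card: "card ({..n} - {k}) = n" using k by simp
    have "(\<Sum>i\<in>{..n} - {k}. log_plus (cmod (z i))) \<le> (\<Sum>i<Suc n. log_plus (cmod (z i)))"
      by (intro sum_mono2) (auto simp: log_plus_def)
    also have "\<dots> \<le> A * Suc n" by (rule A) simp
    \<comment> \<open>Here \<open>Suc n \<le> 2 * n\<close> makes the whole prefactor scale with
      \<open>n\<close>; it is the source of \<open>2 * A\<close> in \<open>K\<close>.\<close>
    also have "\<dots> \<le> A * (2 * n)"
    proof (rule mult_left_mono)
      have "0 \<le> log_plus (cmod (z 0))" by (simp add: log_plus_def)
      then show "0 \<le> A" using A[of 1] by simp
    qed (use n in auto)
    finally have "(\<Sum>i\<in>{..n} - {k}. log_plus (cmod (z i))) + n * (ln (1 + R) + T) \<le> n * K"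
      by (simp add: K_def algebra_simps)
    then have "((\<Sum>i\<in>{..n} - {k}. log_plus (cmod (z i))) + n * (ln (1 + R) + T)) * (\<integral>x. b k x \<partial>lborel)
        \<le> n * K * (\<integral>x. b k x \<partial>lborel)"
      by (intro mult_right_mono b0)
    then show ?thesis
      using integral_abs_ln_diff_le[OF pos(3,2,1)]
      unfolding card ln_gap_def b_def V_def J_def by linarith
  qed
  have "(\<Sum>k\<le>n. ln_gap R n k)
      \<le> (\<Sum>k\<le>n. (V * ln (1 + n) + J + V * (n * \<delta>) + 4 / T * n * J) + n * K * (\<integral>x. b k x \<partial>lborel))"
    by (intro sum_mono gap) simp
  also have "\<dots> = (n + 1) * (V * ln (1 + n) + J + V * (n * \<delta>) + 4 / T * n * J) + n * K * (\<Sum>k\<le>n. \<integral>x. b k x \<partial>lborel)"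
    by (simp add: sum.distrib sum_distrib_left)
  also have "(\<Sum>k\<le>n. \<integral>x. b k x \<partial>lborel) = (\<integral>x. (\<Sum>k\<le>n. b k x) \<partial>lborel)"
    by (subst Bochner_Integration.integral_sum) (auto simp: ib)
  also have "(\<lambda>x. \<Sum>k\<le>n. b k x) = (\<lambda>x. (n + 1) * (indicator (ball 0 R) x * (card (cancelling \<delta> n x) / (n + 1))))"
    unfolding card_cancelling b_def by (simp add: sum_distrib_left fun_eq_iff)
  finally have "(\<Sum>k\<le>n. ln_gap R n k) \<le> (n + 1) * (V * ln (1 + n) + J + V * (n * \<delta>) + 4 / T * n * J)
      + n * K * ((n + 1) * (\<integral>x. indicator (ball 0 R) x * (card (cancelling \<delta> n x) / (n + 1)) \<partial>lborel))"
    by simp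
  moreover define \<beta> where "\<beta> = (\<integral>x. indicator (ball 0 R) x * (card (cancelling \<delta> n x) / (n + 1)) \<partial>lborel)"
  moreover define l where "l = ln (1 + real n)"
  ultimately have "(\<Sum>k\<le>n. ln_gap R n k) \<le> (n + 1) * (V * l + J + V * (n * \<delta>) + 4 / T * n * J) + n * K * ((n + 1) * \<beta>)"
    by simp
  also have "\<dots> = (real n * (n + 1)) * (V * (l / n) + J / n + V * \<delta> + 4 / T * J + K * \<beta>)"
    using n pos(2) by (simp add: field_simps)
  finally show ?thesis unfolding K_def \<beta>_def l_def using n by (subst pos_divide_le_eq) (auto simp: mult.commute add.commute)
qed

text \<open>Only \<open>V * \<delta>\<close> and \<open>4 / T * J\<close> survive as
  \<open>n\<close> grows, and both are made small in advance. The factor of the cancelling integral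
  depends on \<open>T\<close> and may be huge, but it is fixed before \<open>n\<close>.\<close>

lemma average_ln_gap_tendsto_0:
  assumes "log_Cesaro_bounded z" and R: "R > 0"
  shows "(\<lambda>n. (\<Sum>k\<le>n. ln_gap R n k) / (real n * (n + 1))) \<longlonglongrightarrow> 0"
proof (rule order_tendstoI)
  fix e :: real assume e: "0 < e"
  obtain A where A': "\<forall>m\<in>{1..}. \<bar>(\<Sum>i<m. log_plus (cmod (z i))) / real m\<bar> \<le> A"
    using assms(1) unfolding log_Cesaro_bounded_def bounded_iff by auto
  have A: "(\<Sum>i<m. log_plus (cmod (z i))) \<le> A * m" if "m \<ge> 1" for m
    using bspec[OF A', of m] that by (auto simp: field_simps abs_le_iff)
  define V where "V = measure lborel (ball (0::complex) R)"
  define J where "J = (\<integral>z. inv_bump z \<partial>lborel)"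
  have V0: "0 \<le> V" by (simp add: V_def)
  have J0: "0 \<le> J" unfolding J_def by (intro integral_nonneg_AE) auto
  \<comment> \<open>These choices make both surviving terms at most \<open>e / 4\<close>; adding 1
    to \<open>V\<close> and \<open>J\<close> covers the value 0.\<close>
  define \<delta> where "\<delta> = e / (4 * (V + 1))"
  define T where "T = 16 * (J + 1) / e"
  have d: "\<delta> > 0" and T: "T > 0" using e V0 J0 by (auto simp: \<delta>_def T_def)
  have "V * \<delta> \<le> e / 4" using V0 e by (simp add: \<delta>_def field_simps)
  moreover have "4 / T * J \<le> e / 4" using J0 e by (simp add: T_def field_simps)
  ultimately have lt: "V * 0 + 0 + V * \<delta> + 4 / T * J + (2 * A + ln (1 + R) + T) * 0 < e" using e by simp
  have l1: "(\<lambda>n. ln (1 + real n) / n) \<longlonglongrightarrow> 0" and l2: "(\<lambda>n. J / real n) \<longlonglongrightarrow> 0" by real_asymp+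
  have "(\<lambda>n. V * (ln (1 + real n) / n) + J / n + V * \<delta> + 4 / T * J
      + (2 * A + ln (1 + R) + T) * (\<integral>x. indicator (ball 0 R) x * (card (cancelling \<delta> n x) / (n + 1)) \<partial>lborel))
      \<longlonglongrightarrow> V * 0 + 0 + V * \<delta> + 4 / T * J + (2 * A + ln (1 + R) + T) * 0"
    by (intro tendsto_intros l1 l2 integral_cancelling_density_tendsto_0 d)
  from order_tendstoD(2)[OF this lt]
  show "\<forall>\<^sub>F n in sequentially. (\<Sum>k\<le>n. ln_gap R n k) / (real n * (n + 1)) < e"
    using eventually_ge_at_top[of 1]
  proof eventually_elim
    case (elim n)
    then show ?case using sum_ln_gap_le[OF A elim(2) d T R] by (simp add: V_def J_def add_ac)
  qed
next
  fix e :: real assume e: "e < 0"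
  have "0 \<le> (\<Sum>k\<le>n. ln_gap R n k) / (real n * (n + 1))" for n
    by (intro divide_nonneg_nonneg sum_nonneg ln_gap_nonneg) auto
  then show "\<forall>\<^sub>F n in sequentially. e < (\<Sum>k\<le>n. ln_gap R n k) / (real n * (n + 1))"
    using e by (intro always_eventually) (auto intro: less_le_trans)
qed

end

section \<open>Critical points after removing a random root\<close>

text \<open>Index sets of density 0 form an ideal. Taken with \<open>X = Y\<close>, this also serves
  as monotonicity.\<close>

lemma density_Un_tendsto_0:
  fixes X Y Z :: "nat \<Rightarrow> nat set"
  assumes X: "(\<lambda>n. card (X n) / (n + 1)) \<longlonglongrightarrow> 0" and Y: "(\<lambda>n. card (Y n) / (n + 1)) \<longlonglongrightarrow> 0"
    and fin: "\<And>n. finite (X n)" "\<And>n. finite (Y n)" and Z: "\<And>n. Z n \<subseteq> X n \<union> Y n"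
  shows "(\<lambda>n. card (Z n) / (n + 1)) \<longlonglongrightarrow> 0"
proof (rule tendsto_sandwich[OF _ _ tendsto_const])
  show "(\<lambda>n. card (X n) / (n + 1) + card (Y n) / (n + 1)) \<longlonglongrightarrow> 0"
    using tendsto_add[OF X Y] by simp
  have "card (Z n) \<le> card (X n) + card (Y n)" for n
    using card_mono[OF _ Z[of n]] card_Un_le[of "X n" "Y n"] fin by (meson finite_UnI order.trans)
  then have "real (card (Z n)) \<le> real (card (X n)) + real (card (Y n))" for n
    by (metis of_nat_add of_nat_le_iff)
  then show "\<forall>\<^sub>F n in sequentially. card (Z n) / (n + 1) \<le> card (X n) / (n + 1) + card (Y n) / (n + 1)"
    by (intro always_eventually) (simp add: divide_right_mono flip: add_divide_distrib)
qed auto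

lemma abs_sum_mset_diff_le:
  fixes F \<phi> :: "'a \<Rightarrow> real"
  assumes "\<And>x. \<bar>F x - \<phi> x\<bar> \<le> e"
  shows "\<bar>(\<Sum>x\<in>#A. F x) - (\<Sum>x\<in>#A. \<phi> x)\<bar> \<le> e * size A"
proof (induction A)
  case (add x A)
  then show ?case using assms[of x] by (simp add: algebra_simps)
qed simp

lemma root_removed_eq:
  assumes "k \<le> n"
  shows "root_removed z n k = linear_prod z ({..n} - {k})"
proof -
  have "(\<Prod>i\<le>n. [:- z i, 1:]) = [:- z k, 1:] * linear_prod z ({..n} - {k})"
    unfolding linear_prod_def using assms by (intro prod.remove) auto
  then show ?thesis unfolding root_removed_def by (simp del: mult_pCons_left)
qed

lemma linear_factors_remove:
  assumes "n \<ge> 1"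
  shows "linear_factors ({..n} - {k})"
proof
  have "(if k = 0 then 1 else 0) \<in> {..n} - {k}" using assms by auto
  then show "{..n} - {k} \<noteq> {}" by blast
qed auto

lemma integral_zeros_measure:
  fixes f :: "complex \<Rightarrow> real"
  assumes "f \<in> borel_measurable borel" "degree p > 0"
  shows "integral\<^sup>L (zeros_measure p) f = (\<Sum>x\<in>#proots p. f x) / degree p"
proof -
  have "proots p \<noteq> {#}" using size_proots_complex[of p] assms(2) by auto
  then show ?thesis using assms(1)
    by (simp add: zeros_measure_def integral_uniform_on_mset size_proots_complex)
qed

lemma zeros_measure_in_borel_probs: "zeros_measure p \<in> borel_probs"
  by (simp add: zeros_measure_def uniform_on_mset_in_borel_probs)

text \<open>The mass beyond the cutoff is expressed through the integral of \<open>u\<close>, itself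
  compactly supported in the application. Tightness of the critical measures thus comes from testing
  against \<open>u\<close>.\<close>

lemma abs_integral_diff_cutoff_le:
  fixes f u :: "complex \<Rightarrow> real"
  assumes \<nu>: "\<nu> \<in> borel_probs" and [measurable]: "f \<in> borel_measurable borel" "u \<in> borel_measurable borel"
    and f: "\<And>x. \<bar>f x\<bar> \<le> C" and u: "\<And>x. 0 \<le> u x" "\<And>x. u x \<le> 1"
  shows "\<bar>integral\<^sup>L \<nu> f - integral\<^sup>L \<nu> (\<lambda>x. f x * u x)\<bar> \<le> C * (1 - integral\<^sup>L \<nu> u)"
proof -
  interpret prob_space \<nu> using \<nu> by (simp add: borel_probs_def)
  have sets: "sets \<nu> = sets borel" using \<nu> by (simp add: borel_probs_def)
  have C: "0 \<le> C" using f[of 0] by linarith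
  have int: "integrable \<nu> g" if "g \<in> borel_measurable borel" "\<And>x. \<bar>g x\<bar> \<le> B" for g :: "complex \<Rightarrow> real" and B
    by (intro integrable_const_bound[of _ B]) (use that in \<open>auto simp: measurable_cong_sets[OF sets refl]\<close>)
  have if1: "integrable \<nu> f" by (rule int[of _ C]) (use f in auto)
  have if2: "integrable \<nu> u" by (rule int[of _ 1]) (use u in auto)
  have "\<bar>f x * u x\<bar> \<le> C * 1" for x
    unfolding abs_mult using f u C by (intro mult_mono) auto
  then have if3: "integrable \<nu> (\<lambda>x. f x * u x)" by (intro int[of _ C]) auto
  have "norm (\<integral>x. f x - f x * u x \<partial>\<nu>) \<le> (\<integral>x. C * (1 - u x) \<partial>\<nu>)"
  proof (rule Bochner_Integration.integral_norm_bound_integral)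
    fix x
    have "\<bar>f x\<bar> * (1 - u x) \<le> C * (1 - u x)" using f u(2)[of x] by (intro mult_right_mono) auto
    moreover have "f x - f x * u x = f x * (1 - u x)" by (simp add: algebra_simps)
    ultimately show "norm (f x - f x * u x) \<le> C * (1 - u x)" using u(2)[of x] by (simp add: abs_mult)
  qed (use if1 if2 if3 in auto)
  then show ?thesis using if1 if2 if3 by (simp add: prob_space)
qed

section \<open>Densities of indices with deviating critical measures\<close>

locale log_bounded_equidistributed = equidistributed_non_atomic +
  assumes log_bounded: "log_Cesaro_bounded z"
begin

text \<open>Indexed by the removed \<open>k\<close> and not by an outcome: as \<open>s n\<close> is
  uniform, probabilities are densities of index sets and the estimates become deterministic.\<close>

definition crit_measure :: "nat \<Rightarrow> nat \<Rightarrow> complex measure" where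
  "crit_measure n k = zeros_measure (pderiv (root_removed z n k))"

definition deviating :: "(complex \<Rightarrow> real) \<Rightarrow> real \<Rightarrow> nat \<Rightarrow> nat set" where
  "deviating f \<eta> n = {k. k \<le> n \<and> \<eta> \<le> \<bar>integral\<^sup>L (crit_measure n k) f - integral\<^sup>L \<mu> f\<bar>}"

lemma finite_deviating [simp]: "finite (deviating f \<eta> n)"
  by (simp add: deviating_def)

lemma abs_integral_crit_measure_diff_le:
  fixes F h :: "complex \<Rightarrow> real"
  assumes [measurable]: "F \<in> borel_measurable borel" "h \<in> borel_measurable borel"
    and C: "\<And>x. \<bar>F x\<bar> \<le> C"
    and h: "\<And>x. \<bar>h x\<bar> \<le> H" "\<And>x. R \<le> cmod x \<Longrightarrow> h x = 0" "(\<integral>x. h x \<partial>lborel) = 0"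
    and approx: "\<And>w. \<bar>F w - (\<integral>x. h x * ln (cmod (x - w)) \<partial>lborel)\<bar> \<le> e"
    and n: "n \<ge> 3" and k: "k \<le> n"
  shows "\<bar>integral\<^sup>L (crit_measure n k) F - m\<bar>
    \<le> 2 * \<bar>(\<Sum>i<Suc n. F (z i)) / Suc n - m\<bar> + (2 * \<bar>m\<bar> + C) / (real n - 1) + 3 / 2 * H * (ln_gap R n k / n) + 3 * e"
proof -
  interpret linear_factors z "{..n} - {k}" using n by (intro linear_factors_remove) auto
  have card: "card ({..n} - {k}) = n" using k by simp
  define \<phi> where "\<phi> w = (\<integral>x. h x * ln (cmod (x - w)) \<partial>lborel)" for w
  define a where "a = (\<Sum>x\<in>#proots (pderiv P). F x)"
  define S where "S = (\<Sum>i<Suc n. F (z i))"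
  define g where "g = ln_gap R n k"
  have g0: "0 \<le> g" by (simp add: g_def ln_gap_nonneg)
  have H0: "0 \<le> H" using h(1)[of 0] by linarith
  have e0: "0 \<le> e" using approx[of 0] by linarith
  have C0: "0 \<le> C" using C[of 0] by linarith
  have deg: "degree (pderiv P) = n - 1" using size_proots_complex[of "pderiv P"] size_proots_pderiv_P card by simp
  have int: "integral\<^sup>L (crit_measure n k) F = a / (real n - 1)"
    using n deg by (simp add: crit_measure_def root_removed_eq[OF k] integral_zeros_measure a_def of_nat_diff)
  have "(\<Sum>i\<le>n. F (z i)) = F (z k) + (\<Sum>i\<in>{..n} - {k}. F (z i))" using k by (intro sum.remove) auto
  then have proots: "(\<Sum>x\<in>#proots P. F x) = S - F (z k)"
    by (simp add: proots_P S_def image_mset.compositionality o_def sum_unfold_sum_mset lessThan_Suc_atMost)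
  have "\<bar>(\<Sum>x\<in>#proots (pderiv P). \<phi> x) - (\<Sum>x\<in>#proots P. \<phi> x)\<bar> \<le> H * g"
    unfolding \<phi>_def g_def ln_gap_def using h P_nonzero pderiv_P_nonzero by (intro log_potential_diff_proots) auto
  moreover have "\<bar>a - (\<Sum>x\<in>#proots (pderiv P). \<phi> x)\<bar> \<le> e * n"
  proof -
    have "\<bar>a - (\<Sum>x\<in>#proots (pderiv P). \<phi> x)\<bar> \<le> e * size (proots (pderiv P))"
      unfolding a_def by (rule abs_sum_mset_diff_le) (use approx in \<open>simp add: \<phi>_def\<close>)
    also have "\<dots> \<le> e * n" using e0 by (intro mult_left_mono) (auto simp: size_proots_pderiv_P card)
    finally show ?thesis .
  qed
  moreover have "\<bar>(\<Sum>x\<in>#proots P. F x) - (\<Sum>x\<in>#proots P. \<phi> x)\<bar> \<le> e * n"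
    using abs_sum_mset_diff_le[of F \<phi> e "proots P"] approx by (simp add: \<phi>_def proots_P card)
  ultimately have a: "\<bar>a - (S - F (z k))\<bar> \<le> H * g + 2 * (e * n)"
    unfolding proots by linarith
  \<comment> \<open>The term \<open>2 * m\<close> is the mismatch between \<open>n - 1\<close>
    critical points and \<open>n + 1\<close> points of the sequence; \<open>F (z k)\<close> accounts
    for the removed root.\<close>
  have "a - m * (real n - 1) = (a - (S - F (z k))) + (S - m * Suc n) + (2 * m - F (z k))"
    by (simp add: algebra_simps)
  then have "\<bar>a - m * (real n - 1)\<bar> \<le> H * g + 2 * (e * n) + \<bar>S - m * Suc n\<bar> + (2 * \<bar>m\<bar> + C)"
    using a C[of "z k"] by linarith
  also have "S - m * Suc n = Suc n * (S / Suc n - m)" by (simp add: field_simps)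
  finally have bound: "\<bar>a - m * (real n - 1)\<bar> \<le> H * g + 2 * (e * n) + Suc n * \<bar>S / Suc n - m\<bar> + (2 * \<bar>m\<bar> + C)"
    by (simp add: abs_mult)
  have n1: "real n - 1 > 0" using n by simp
  have "a / (real n - 1) - m = (a - m * (real n - 1)) / (real n - 1)" using n1 by (simp add: field_simps)
  then have "\<bar>a / (real n - 1) - m\<bar> = \<bar>a - m * (real n - 1)\<bar> / (real n - 1)" using n1 by simp
  also have "\<dots> \<le> (H * g + 2 * (e * n) + Suc n * \<bar>S / Suc n - m\<bar> + (2 * \<bar>m\<bar> + C)) / (real n - 1)"
    using bound n1 by (intro divide_right_mono) auto
  also have "\<dots> = H * g / (real n - 1) + 2 * e * (n / (real n - 1)) + \<bar>S / Suc n - m\<bar> * (Suc n / (real n - 1))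
      + (2 * \<bar>m\<bar> + C) / (real n - 1)"
    by (simp add: add_divide_distrib mult_ac del: of_nat_Suc)
  \<comment> \<open>For \<open>n \<ge> 3\<close>, \<open>1 / (n - 1)\<close> is at most
    \<open>3 / (2 * n)\<close>, \<open>n / (n - 1)\<close> at most \<open>3 / 2\<close> and
    \<open>(n + 1) / (n - 1)\<close> at most 2, with equality at 3.\<close>
  also have "\<dots> \<le> 3 / 2 * H * (g / n) + 2 * e * (3 / 2) + \<bar>S / Suc n - m\<bar> * 2 + (2 * \<bar>m\<bar> + C) / (real n - 1)"
  proof (intro add_mono order.refl mult_left_mono)
    have "1 / (real n - 1) \<le> 3 / 2 / n" using n by (simp add: field_simps)
    from mult_left_mono[OF this, of "H * g"] show "H * g / (real n - 1) \<le> 3 / 2 * H * (g / n)"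
      using H0 g0 by simp
  qed (use n e0 in \<open>auto simp: field_simps\<close>)
  finally show ?thesis by (simp add: int S_def g_def mult.commute)
qed

text \<open>Markov's inequality: a deviating index has \<open>ln_gap\<close> at least a fixed
  multiple of \<open>n\<close>, while the average of \<open>ln_gap / n\<close> over the indices
  tends to 0.\<close>

lemma deviating_density_compact_support:
  fixes F :: "complex \<Rightarrow> real"
  assumes F: "continuous_on UNIV F" "\<And>x. R \<le> cmod x \<Longrightarrow> F x = 0" and \<eta>: "\<eta> > 0"
  shows "(\<lambda>n. card (deviating F \<eta> n) / (n + 1)) \<longlonglongrightarrow> 0"
proof -
  obtain C where C: "\<And>x. \<bar>F x\<bar> \<le> C"
    using compact_support_bounded_uniformly_continuous(1)[OF F] by blast
  have [measurable]: "F \<in> borel_measurable borel" by (rule borel_measurable_continuous_onI[OF F(1)])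
  \<comment> \<open>The accuracy \<open>\<eta> / 12\<close> is tripled by the previous bound; with
    another \<open>\<eta> / 4\<close> for the vanishing terms, at least \<open>\<eta> / 2\<close> is
    left to the gap.\<close>
  obtain h H R' where h [measurable]: "h \<in> borel_measurable borel"
    and h': "\<And>x. \<bar>h x\<bar> \<le> H" "\<And>x. R' \<le> cmod x \<Longrightarrow> h x = 0" "(\<integral>x. h x \<partial>lborel) = 0"
    and approx: "\<And>w. \<bar>F w - (\<integral>x. h x * ln (cmod (x - w)) \<partial>lborel)\<bar> \<le> \<eta> / 12"
    using log_potential_dense[where F = F and R = R and e = "\<eta> / 12", OF F] \<eta> by auto
  define K where "K = H + 1"
  have "0 \<le> H" using h'(1)[of 0] by linarith
  then have K: "K > 0" "\<And>x. \<bar>h x\<bar> \<le> K" using h'(1) by (auto simp: K_def intro: add_increasing2)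
  define \<rho> where "\<rho> = max R' 1"
  have \<rho>: "\<rho> > 0" "\<And>x. \<rho> \<le> cmod x \<Longrightarrow> h x = 0" using h'(2) by (auto simp: \<rho>_def)
  define m where "m = integral\<^sup>L \<mu> F"
  have "(\<lambda>n. (\<Sum>i<n. F (z i)) / n) \<longlonglongrightarrow> m"
    unfolding m_def by (rule mu_distributed_tendsto[OF distributed F(1)]) (use C in \<open>auto simp: bounded_iff\<close>)
  then have l1: "(\<lambda>n. (\<Sum>i<Suc n. F (z i)) / Suc n) \<longlonglongrightarrow> m" by (rule LIMSEQ_Suc)
  have l2: "(\<lambda>n. (2 * \<bar>m\<bar> + C) / (real n - 1)) \<longlonglongrightarrow> 0" by real_asymp
  have "(\<lambda>n. 2 * \<bar>(\<Sum>i<Suc n. F (z i)) / Suc n - m\<bar> + (2 * \<bar>m\<bar> + C) / (real n - 1)) \<longlonglongrightarrow> 2 * \<bar>m - m\<bar> + 0"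
    by (intro tendsto_intros l1 l2)
  then have "(\<lambda>n. 2 * \<bar>(\<Sum>i<Suc n. F (z i)) / Suc n - m\<bar> + (2 * \<bar>m\<bar> + C) / (real n - 1)) \<longlonglongrightarrow> 0" by simp
  from order_tendstoD(2)[OF this, of "\<eta> / 4"] \<eta>
  have ev: "\<forall>\<^sub>F n in sequentially. 2 * \<bar>(\<Sum>i<Suc n. F (z i)) / Suc n - m\<bar> + (2 * \<bar>m\<bar> + C) / (real n - 1) < \<eta> / 4" by simp
  show ?thesis
  proof (rule tendsto_sandwich[OF _ _ tendsto_const])
    show "(\<lambda>n. 3 * K / \<eta> * ((\<Sum>k\<le>n. ln_gap \<rho> n k) / (real n * (n + 1)))) \<longlonglongrightarrow> 0"
      by (intro tendsto_mult_right_zero average_ln_gap_tendsto_0 log_bounded \<rho>)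
    show "\<forall>\<^sub>F n in sequentially. card (deviating F \<eta> n) / (n + 1)
        \<le> 3 * K / \<eta> * ((\<Sum>k\<le>n. ln_gap \<rho> n k) / (real n * (n + 1)))"
      using ev eventually_ge_at_top[of 3]
    proof eventually_elim
      case (elim n)
      have gap: "\<eta> * n / (3 * K) \<le> ln_gap \<rho> n k" if "k \<in> deviating F \<eta> n" for k
      proof -
        have k: "k \<le> n" "\<eta> \<le> \<bar>integral\<^sup>L (crit_measure n k) F - m\<bar>"
          using that by (auto simp: deviating_def m_def)
        have "\<bar>integral\<^sup>L (crit_measure n k) F - m\<bar>
          \<le> 2 * \<bar>(\<Sum>i<Suc n. F (z i)) / Suc n - m\<bar> + (2 * \<bar>m\<bar> + C) / (real n - 1) + 3 / 2 * K * (ln_gap \<rho> n k / n) + 3 * (\<eta> / 12)"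
          by (rule abs_integral_crit_measure_diff_le[where h = h])
             (use C K \<rho> h'(3) approx elim k in auto)
        then have "\<eta> / 2 \<le> 3 / 2 * K * (ln_gap \<rho> n k / n)" using k(2) elim(1) by linarith
        then show ?thesis using K(1) elim(2) by (simp add: field_simps)
      qed
      have "card (deviating F \<eta> n) * (\<eta> * n / (3 * K)) = (\<Sum>k\<in>deviating F \<eta> n. \<eta> * n / (3 * K))" by simp
      also have "\<dots> \<le> (\<Sum>k\<in>deviating F \<eta> n. ln_gap \<rho> n k)" by (intro sum_mono gap)
      also have "\<dots> \<le> (\<Sum>k\<le>n. ln_gap \<rho> n k)"
        by (intro sum_mono2) (auto simp: deviating_def ln_gap_nonneg)
      finally have "card (deviating F \<eta> n) \<le> 3 * K / \<eta> * ((\<Sum>k\<le>n. ln_gap \<rho> n k) / n)"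
        using K(1) \<eta> elim(2) by (simp add: field_simps)
      then have "card (deviating F \<eta> n) / (n + 1) \<le> 3 * K / \<eta> * ((\<Sum>k\<le>n. ln_gap \<rho> n k) / n) / (n + 1)"
        by (intro divide_right_mono) auto
      then show ?case by simp
    qed
  qed auto
qed

lemma mu_in_borel_probs: "\<mu> \<in> borel_probs"
  using sets_mu prob_space_axioms by (simp add: borel_probs_def)

lemma deviating_density_tendsto_0:
  fixes f :: "complex \<Rightarrow> real"
  assumes f: "continuous_on UNIV f" "bounded (range f)" and \<eta>: "\<eta> > 0"
  shows "(\<lambda>n. card (deviating f \<eta> n) / (n + 1)) \<longlonglongrightarrow> 0"
proof -
  obtain C' where "\<And>x. \<bar>f x\<bar> \<le> C'" using f(2) by (auto simp: bounded_iff)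
  then have C: "\<bar>f x\<bar> \<le> \<bar>C'\<bar> + 1" for x by (rule order.trans) simp
  define C where "C = \<bar>C'\<bar> + 1"
  have C0: "C > 0" by (simp add: C_def)
  obtain R where R: "R > 0" "measure \<mu> {x. R < cmod x} < \<eta> / (6 * C)"
    using tight[of "\<eta> / (6 * C)"] \<eta> C0 by auto
  define u where "u x = max 0 (min 1 (R + 1 - cmod x))" for x :: complex
  have u: "continuous_on UNIV u" "\<And>x. 0 \<le> u x" "\<And>x. u x \<le> 1" "\<And>x. R + 1 \<le> cmod x \<Longrightarrow> u x = 0"
    unfolding u_def by (auto intro!: continuous_intros)
  have fu: "continuous_on UNIV (\<lambda>x. f x * u x)" "\<And>x. R + 1 \<le> cmod x \<Longrightarrow> f x * u x = 0"
    using f u by (auto intro!: continuous_intros)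
  have [measurable]: "f \<in> borel_measurable borel" "u \<in> borel_measurable borel"
    using f u by (auto intro: borel_measurable_continuous_onI)
  have bdu: "bounded (range u)" using u by (auto simp: bounded_iff intro!: exI[of _ 1])
  have "1 - integral\<^sup>L \<mu> u = (\<integral>x. 1 - u x \<partial>\<mu>)"
    using integrable_mu[of u] bdu prob_space by simp
  also have "\<dots> \<le> (\<integral>x. indicator {x. R < cmod x} x \<partial>\<mu>)"
  proof (rule integral_mono)
    show "integrable \<mu> (\<lambda>x. 1 - u x)" using integrable_mu[of u] bdu by simp
    show "integrable \<mu> (indicat_real {x. R < cmod x})"
      by (rule integrable_mu) (auto simp: bounded_iff indicator_def intro!: exI[of _ "1::real"])
  qed (auto simp: u_def indicator_def)
  also have "\<dots> < \<eta> / (6 * C)" using R by simp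
  finally have small: "C * (1 - integral\<^sup>L \<mu> u) < \<eta> / 6" using C0 by (simp add: field_simps)
  \<comment> \<open>The tail under \<open>\<mu>\<close> costs less than \<open>\<eta> / 6\<close>,
    the tail under the critical measure less than \<open>\<eta> / 6 + \<eta> / 3\<close>, the
    compactly supported part less than \<open>\<eta> / 3\<close>: together less than
    \<open>\<eta>\<close>.\<close>
  show ?thesis
  proof (rule density_Un_tendsto_0)
    show "(\<lambda>n. card (deviating (\<lambda>x. f x * u x) (\<eta> / 3) n) / (n + 1)) \<longlonglongrightarrow> 0"
      by (rule deviating_density_compact_support[OF fu]) (use \<eta> in auto)
    show "(\<lambda>n. card (deviating u (\<eta> / (3 * C)) n) / (n + 1)) \<longlonglongrightarrow> 0"
      by (rule deviating_density_compact_support[OF u(1,4)]) (use \<eta> C0 in auto)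
    fix n
    show "deviating f \<eta> n \<subseteq> deviating (\<lambda>x. f x * u x) (\<eta> / 3) n \<union> deviating u (\<eta> / (3 * C)) n"
    proof (rule subsetI, rule ccontr)
      fix k assume k: "k \<in> deviating f \<eta> n"
        and "k \<notin> deviating (\<lambda>x. f x * u x) (\<eta> / 3) n \<union> deviating u (\<eta> / (3 * C)) n"
      then have far: "\<eta> \<le> \<bar>integral\<^sup>L (crit_measure n k) f - integral\<^sup>L \<mu> f\<bar>"
        and near1: "\<bar>integral\<^sup>L (crit_measure n k) (\<lambda>x. f x * u x) - integral\<^sup>L \<mu> (\<lambda>x. f x * u x)\<bar> < \<eta> / 3"
        and near2: "\<bar>integral\<^sup>L (crit_measure n k) u - integral\<^sup>L \<mu> u\<bar> < \<eta> / (3 * C)"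
        by (auto simp: deviating_def)
      have "C * \<bar>integral\<^sup>L (crit_measure n k) u - integral\<^sup>L \<mu> u\<bar> < \<eta> / 3"
        using near2 C0 by (simp add: field_simps)
      then have near3: "\<bar>C * integral\<^sup>L (crit_measure n k) u - C * integral\<^sup>L \<mu> u\<bar> < \<eta> / 3"
        using C0 by (simp add: abs_mult flip: right_diff_distrib)
      have crit: "crit_measure n k \<in> borel_probs"
        by (simp add: crit_measure_def zeros_measure_in_borel_probs)
      have "\<bar>integral\<^sup>L (crit_measure n k) f - integral\<^sup>L (crit_measure n k) (\<lambda>x. f x * u x)\<bar> \<le> C * (1 - integral\<^sup>L (crit_measure n k) u)"
        by (rule abs_integral_diff_cutoff_le[OF crit]) (use C u in \<open>auto simp: C_def\<close>)
      moreover have "\<bar>integral\<^sup>L \<mu> f - integral\<^sup>L \<mu> (\<lambda>x. f x * u x)\<bar> \<le> C * (1 - integral\<^sup>L \<mu> u)"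
        by (rule abs_integral_diff_cutoff_le[OF mu_in_borel_probs]) (use C u in \<open>auto simp: C_def\<close>)
      ultimately show False using far near1 near3 small unfolding right_diff_distrib by linarith
    qed
  qed auto
qed

text \<open>Induction over the generation of \<open>U\<close> from the subbasis: leaving an
  intersection means leaving one of its two members, a union contains a member already holding
  \<open>\<mu>\<close>, and a subbasic set contains every measure whose integral of one test
  function is close enough to the limit.\<close>

lemma escaping_density_tendsto_0:
  assumes "openin weak_topology U" "\<mu> \<in> U"
  shows "(\<lambda>n. card {k. k \<le> n \<and> crit_measure n k \<notin> U} / (n + 1)) \<longlonglongrightarrow> 0"
proof -
  define S where "S = {{\<nu> \<in> borel_probs. integral\<^sup>L \<nu> f \<in> V} | (f :: complex \<Rightarrow> real) V.
        continuous_on UNIV f \<and> bounded (range f) \<and> open V}"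
  have "generate_topology_on S U"
    using assms(1) by (simp add: weak_topology_def S_def openin_topology_generated_by_iff)
  then show ?thesis using assms(2)
  proof (induction U)
    case Empty
    then show ?case by simp
  next
    case (Int a b)
    then show ?case by (intro density_Un_tendsto_0[OF Int.IH(1) Int.IH(2)]) auto
  next
    case (UN K)
    then obtain a where a: "a \<in> K" "\<mu> \<in> a" by blast
    then show ?case by (intro density_Un_tendsto_0[OF UN.IH(1)[OF a] UN.IH(1)[OF a]]) auto
  next
    case (Basis s)
    then obtain f :: "complex \<Rightarrow> real" and V where s: "s = {\<nu> \<in> borel_probs. integral\<^sup>L \<nu> f \<in> V}"
      and f: "continuous_on UNIV f" "bounded (range f)" and V: "open V" unfolding S_def by blast
    obtain \<eta> where \<eta>: "\<eta> > 0" "ball (integral\<^sup>L \<mu> f) \<eta> \<subseteq> V"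
      using V Basis(2) s by (auto simp: open_contains_ball)
    have "{k. k \<le> n \<and> crit_measure n k \<notin> s} \<subseteq> deviating f \<eta> n \<union> deviating f \<eta> n" for n
    proof
      fix k assume k: "k \<in> {k. k \<le> n \<and> crit_measure n k \<notin> s}"
      have "crit_measure n k \<in> borel_probs"
        by (simp add: crit_measure_def zeros_measure_in_borel_probs)
      then have "integral\<^sup>L (crit_measure n k) f \<notin> ball (integral\<^sup>L \<mu> f) \<eta>" using k s \<eta>(2) by auto
      then show "k \<in> deviating f \<eta> n \<union> deviating f \<eta> n"
        using k by (auto simp: deviating_def dist_real_def abs_minus_commute)
    qed
    then show ?case
      by (intro density_Un_tendsto_0[OF deviating_density_tendsto_0[OF f \<eta>(1)] deviating_density_tendsto_0[OF f \<eta>(1)]]) auto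
  qed
qed

end

section \<open>Convergence of the zeros, and the passage from densities to probabilities\<close>

lemma limitin_zeros_measure_root_removed:
  assumes "prob_space \<mu>" "sets \<mu> = sets borel" and z: "mu_distributed \<mu> z" and k: "\<And>n. k n \<le> n"
  shows "limitin weak_topology (\<lambda>n. zeros_measure (root_removed z n (k n))) \<mu> sequentially"
  unfolding limitin_weak_topology_iff
proof (intro conjI allI impI)
  show "\<mu> \<in> borel_probs" using assms(1,2) by (simp add: borel_probs_def)
  show "\<forall>\<^sub>F n in sequentially. zeros_measure (root_removed z n (k n)) \<in> borel_probs"
    by (simp add: zeros_measure_in_borel_probs)
  fix f :: "complex \<Rightarrow> real" assume f: "continuous_on UNIV f \<and> bounded (range f)"
  then have [measurable]: "f \<in> borel_measurable borel" by (intro borel_measurable_continuous_onI) auto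
  obtain C where C: "\<And>x. \<bar>f x\<bar> \<le> C" using f by (auto simp: bounded_iff)
  have l1: "(\<lambda>n. (\<Sum>i<Suc n. f (z i)) / Suc n) \<longlonglongrightarrow> integral\<^sup>L \<mu> f"
    by (rule LIMSEQ_Suc[OF mu_distributed_tendsto]) (use z f in auto)
  have l2: "(\<lambda>n. real (Suc n) / n) \<longlonglongrightarrow> 1" by real_asymp
  have l3: "(\<lambda>n. f (z (k n)) / n) \<longlonglongrightarrow> 0"
  proof (rule Lim_null_comparison)
    show "\<forall>\<^sub>F n in sequentially. norm (f (z (k n)) / n) \<le> C / real n"
      using C by (intro always_eventually) (auto intro: divide_right_mono)
    show "(\<lambda>n. C / real n) \<longlonglongrightarrow> 0" by real_asymp
  qed
  \<comment> \<open>For any choice of the removed indices, dropping one root changes the average of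
    a bounded function by \<open>O(1 / n)\<close>; the ratio \<open>Suc n / n\<close> rescales from
    \<open>n + 1\<close> points to \<open>n\<close> roots.\<close>
  have "(\<lambda>n. (\<Sum>i<Suc n. f (z i)) / Suc n * (Suc n / n) - f (z (k n)) / n) \<longlonglongrightarrow> integral\<^sup>L \<mu> f * 1 - 0"
    by (intro tendsto_intros l1 l2 l3)
  moreover have "integral\<^sup>L (zeros_measure (root_removed z n (k n))) f
      = (\<Sum>i<Suc n. f (z i)) / Suc n * (Suc n / n) - f (z (k n)) / n" if n: "n \<ge> 1" for n
  proof -
    interpret linear_factors z "{..n} - {k n}" using n by (rule linear_factors_remove)
    have card: "card ({..n} - {k n}) = n" using k[of n] by simp
    have "(\<Sum>i\<le>n. f (z i)) = f (z (k n)) + (\<Sum>i\<in>{..n} - {k n}. f (z i))"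
      using k[of n] by (intro sum.remove) auto
    then have "(\<Sum>x\<in>#proots P. f x) = (\<Sum>i<Suc n. f (z i)) - f (z (k n))"
      by (simp add: proots_P image_mset.compositionality o_def sum_unfold_sum_mset lessThan_Suc_atMost)
    then show ?thesis using n
      by (simp add: root_removed_eq[OF k] integral_zeros_measure degree_P card diff_divide_distrib del: sum.lessThan_Suc)
  qed
  ultimately show "(\<lambda>n. integral\<^sup>L (zeros_measure (root_removed z n (k n))) f) \<longlonglongrightarrow> integral\<^sup>L \<mu> f"
    by (subst tendsto_cong[OF eventually_sequentiallyI[of 1]]) auto
qed

theorem theorem1p5:
  fixes \<mu> :: "complex measure" and z :: "nat \<Rightarrow> complex"
    and M :: "'w measure" and s :: "nat \<Rightarrow> 'w \<Rightarrow> nat"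
  assumes "prob_space \<mu>" and "sets \<mu> = sets borel" and "non_atomic \<mu>"
    and "mu_distributed \<mu> z"
    and "log_Cesaro_bounded z"
    and "prob_space M"
    and "\<And>n. s n \<in> measurable M (count_space UNIV)"
    and "\<And>n. distr M (count_space UNIV) (s n) = measure_pmf (pmf_of_set {0..n})"
  shows "(AE \<omega> in M. limitin weak_topology
            (\<lambda>n. zeros_measure (root_removed z n (s n \<omega>))) \<mu> sequentially)
       \<and> tendsto_in_prob M weak_topology
            (\<lambda>n \<omega>. zeros_measure (pderiv (root_removed z n (s n \<omega>)))) \<mu>"
proof
  interpret prob_space M by fact
  \<comment> \<open>The law of \<open>s n\<close> gives this bound only almost surely; the countably
    many null sets are discarded together.\<close>
  have "AE \<omega> in M. s n \<omega> \<le> n" for n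
  proof -
    have "AE k in distr M (count_space UNIV) (s n). k \<le> n"
      unfolding assms(8) by (simp add: AE_measure_pmf_iff)
    then show ?thesis by (subst (asm) AE_distr_iff) (use assms(7) in auto)
  qed
  then have "AE \<omega> in M. \<forall>n. s n \<omega> \<le> n" by (simp add: AE_all_countable)
  then show "AE \<omega> in M. limitin weak_topology (\<lambda>n. zeros_measure (root_removed z n (s n \<omega>))) \<mu> sequentially"
    by eventually_elim (use assms(1,2,4) in \<open>auto intro: limitin_zeros_measure_root_removed\<close>)
next
  interpret M: prob_space M by fact
  interpret log_bounded_equidistributed \<mu> z
    using assms(1-5) by (intro log_bounded_equidistributed.intro equidistributed_non_atomic.intro
        equidistributed.intro equidistributed_axioms.intro equidistributed_non_atomic_axioms.intro
        log_bounded_equidistributed_axioms.intro)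
  show "tendsto_in_prob M weak_topology (\<lambda>n \<omega>. zeros_measure (pderiv (root_removed z n (s n \<omega>)))) \<mu>"
    unfolding tendsto_in_prob_def
  proof (intro conjI allI impI)
    show "\<mu> \<in> topspace weak_topology" using mu_in_borel_probs by simp
    fix n U
    show "{\<omega> \<in> space M. zeros_measure (pderiv (root_removed z n (s n \<omega>))) \<in> U} \<in> sets M"
      using measurable_sets[OF assms(7)[of n], of "{k. zeros_measure (pderiv (root_removed z n k)) \<in> U}"]
      by (simp add: vimage_def Int_def conj_commute)
  next
    fix U assume U: "openin weak_topology U \<and> \<mu> \<in> U"
    \<comment> \<open>Pushing forward to the uniform law of \<open>s n\<close> turns the probability
      into the density of escaping indices.\<close>
    have "measure M {\<omega> \<in> space M. zeros_measure (pderiv (root_removed z n (s n \<omega>))) \<notin> U}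
        = card {k. k \<le> n \<and> crit_measure n k \<notin> U} / (n + 1)" for n
    proof -
      have "measure M {\<omega> \<in> space M. zeros_measure (pderiv (root_removed z n (s n \<omega>))) \<notin> U}
          = measure M (s n -` {k. crit_measure n k \<notin> U} \<inter> space M)"
        by (rule arg_cong[where f = "measure M"]) (auto simp: crit_measure_def)
      also have "\<dots> = measure (distr M (count_space UNIV) (s n)) {k. crit_measure n k \<notin> U}"
        by (rule measure_distr[symmetric]) (use assms(7) in auto)
      also have "\<dots> = card ({0..n} \<inter> {k. crit_measure n k \<notin> U}) / card {0..n}"
        unfolding assms(8) by (rule measure_pmf_of_set) auto
      also have "{0..n} \<inter> {k. crit_measure n k \<notin> U} = {k. k \<le> n \<and> crit_measure n k \<notin> U}" by auto
      finally show ?thesis by simp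
    qed
    then show "(\<lambda>n. measure M {\<omega> \<in> space M. zeros_measure (pderiv (root_removed z n (s n \<omega>))) \<notin> U}) \<longlonglongrightarrow> 0"
      using escaping_density_tendsto_0 U by (simp add: add.commute)
  qed
qed

end
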